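(* Let $\Sigma=\partial K$ be a compact hypersurface in $\mathbb{R}^n$, where $K$ is a compact $n$-dimensional submanifold (with boundary) embedded in $\mathbb{R}^n$ with rectifiable boundary, and let $v\in\mathbb{S}^{n-1}$ be a unit vector. For each $u\in v^\perp$ let $\ell_u=\{u+tv:t\in\mathbb{R}\}$ be the line parallel to $v$ that meets $v^\perp$ at $u$. Then the weighted projected area of $\Sigma$ onto $v^\perp$ satisfies $$\mathcal{V}_{n-1}(\Sigma\,|\,v^\perp)=\frac12\int_{u\in v^\perp}\#(\ell_u\cap\Sigma)\,du ,$$ where $\#(\ell_u\cap\Sigma)$ is the number of intersection points of $\ell_u$ and $\Sigma$ and $du$ is the $(n-1)$-dimensional area element of $v^\perp$ at $u$.
   Context: $v^\perp$ denotes the linear hyperplane of $\mathbb{R}^n$ orthogonal to $v$. The hypersurface $\Sigma$ has area element $d\Sigma_q$ and an outward unit normal $\tilde n(q)$ at almost every $q\in\Sigma$. The weighted projected area of $\Sigma$ along $v$ onto $v^\perp$ is defined by $$\mathcal{V}_{n-1}(\Sigma\,|\,v^\perp)=\frac12\int_{q\in\Sigma}|v\cdot\tilde n(q)|\,d\Sigma_q .$$ (No convexity is assumed.) *)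

theory Defs
  imports "HOL-Analysis.Analysis"
begin

section \<open>Hausdorff measure\<close>

text \<open>
  The constant \<open>unit_ball_vol m / 2 ^ m\<close> is the usual normalisation, for which the
  \<open>m\<close>-dimensional Hausdorff measure is the \<open>m\<close>-dimensional area. The empty set has to be
  treated separately only because \<open>0 ^ 0 = 1\<close>; with this convention the case \<open>m = 0\<close> is the
  counting measure. Boundedness of the covering sets is required because \<^const>\<open>diameter\<close> is
  unspecified on unbounded sets.
\<close>

definition hausdorff_gauge :: "nat \<Rightarrow> 'a::metric_space set \<Rightarrow> ennreal" where
  "hausdorff_gauge m U =
     (if U = {} then 0 else ennreal (unit_ball_vol (real m) * (diameter U / 2) ^ m))"

definition hausdorff_content :: "nat \<Rightarrow> real \<Rightarrow> 'a::metric_space set \<Rightarrow> ennreal" where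
  "hausdorff_content m \<delta> A =
     (INF U \<in> {U :: nat \<Rightarrow> 'a set. A \<subseteq> (\<Union>i. U i) \<and> (\<forall>i. bounded (U i) \<and> diameter (U i) \<le> \<delta>)}.
        \<Sum>i. hausdorff_gauge m (U i))"

definition hausdorff_outer :: "nat \<Rightarrow> 'a::metric_space set \<Rightarrow> ennreal" where
  "hausdorff_outer m A = (SUP \<delta> \<in> {0<..}. hausdorff_content m \<delta> A)"

definition hausdorff_measure :: "nat \<Rightarrow> 'a::metric_space measure" where
  "hausdorff_measure m = measure_of UNIV (sets borel) (hausdorff_outer m)"

lemma hausdorff_content_mono: "A \<subseteq> B \<Longrightarrow> hausdorff_content m \<delta> A \<le> hausdorff_content m \<delta> B"
  unfolding hausdorff_content_def by (rule INF_superset_mono) auto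

lemma hausdorff_content_antimono: "\<delta> \<le> \<epsilon> \<Longrightarrow> hausdorff_content m \<epsilon> A \<le> hausdorff_content m \<delta> A"
  unfolding hausdorff_content_def by (rule INF_superset_mono) (auto intro: order_trans)

lemma hausdorff_outer_mono: "A \<subseteq> B \<Longrightarrow> hausdorff_outer m A \<le> hausdorff_outer m B"
  unfolding hausdorff_outer_def by (intro SUP_subset_mono hausdorff_content_mono order_refl)

lemma hausdorff_content_le_outer: "0 < \<delta> \<Longrightarrow> hausdorff_content m \<delta> A \<le> hausdorff_outer m A"
  unfolding hausdorff_outer_def by (rule SUP_upper) simp

lemma hausdorff_outer_empty [simp]: "hausdorff_outer m {} = 0"
proof -
  have "hausdorff_content m \<delta> {} \<le> 0" if "0 < \<delta>" for \<delta>
    unfolding hausdorff_content_def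
    by (rule INF_lower2[of "\<lambda>_. {}"]) (use that in \<open>auto simp: hausdorff_gauge_def\<close>)
  then show ?thesis
    unfolding hausdorff_outer_def by (auto simp: SUP_le_iff simp flip: le_zero_eq)
qed

lemma hausdorff_content_countably_subadditive:
  fixes A :: "nat \<Rightarrow> 'a::metric_space set"
  shows "hausdorff_content m \<delta> (\<Union>i. A i) \<le> (\<Sum>i. hausdorff_content m \<delta> (A i))"
proof (rule ennreal_le_epsilon)
  fix e :: real
  assume "0 < e" and fin: "(\<Sum>i. hausdorff_content m \<delta> (A i)) < top"
  then have "hausdorff_content m \<delta> (A n) < hausdorff_content m \<delta> (A n) + e * (1/2) ^ Suc n" for n
    by (auto simp: less_top dest!: ennreal_suminf_lessD)
  then have "\<exists>U. A n \<subseteq> (\<Union>i. U i) \<and> (\<forall>i. bounded (U i) \<and> diameter (U i) \<le> \<delta>) \<and>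
      (\<Sum>i. hausdorff_gauge m (U i)) < hausdorff_content m \<delta> (A n) + e * (1/2) ^ Suc n" for n
    unfolding hausdorff_content_def INF_less_iff by auto
  then obtain B where B: "\<And>n. A n \<subseteq> (\<Union>i. B n i)"
      "\<And>n i. bounded (B n i)" "\<And>n i. diameter (B n i) \<le> \<delta>"
      "\<And>n. (\<Sum>i. hausdorff_gauge m (B n i)) < hausdorff_content m \<delta> (A n) + e * (1/2) ^ Suc n"
    by metis
  define C where "C = case_prod B o prod_decode"
  have "(\<Union>i. A i) \<subseteq> (\<Union>i. C i)"
    using B(1) by (auto simp: C_def subset_eq) (metis prod.case prod_encode_inverse)
  moreover have "bounded (C i) \<and> diameter (C i) \<le> \<delta>" for i
    using B(2,3) by (simp add: C_def split_def)
  ultimately have "hausdorff_content m \<delta> (\<Union>i. A i) \<le> (\<Sum>i. hausdorff_gauge m (C i))"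
    unfolding hausdorff_content_def by (intro INF_lower) auto
  also have "\<dots> = (\<Sum>i. (\<lambda>(n, j). hausdorff_gauge m (B n j)) (prod_decode i))"
    by (simp add: C_def split_def comp_def)
  also have "\<dots> = (\<Sum>n. \<Sum>i. hausdorff_gauge m (B n i))"
    by (rule suminf_ennreal_2dimen) simp
  also have "\<dots> \<le> (\<Sum>n. hausdorff_content m \<delta> (A n) + e * (1/2) ^ Suc n)"
    using B(4) by (intro suminf_le) (auto intro: less_imp_le)
  also have "\<dots> = (\<Sum>n. hausdorff_content m \<delta> (A n)) + (\<Sum>n. ennreal e * ennreal ((1/2) ^ Suc n))"
    using \<open>0 < e\<close> by (subst suminf_add[symmetric])
      (auto simp del: ennreal_suminf_cmult simp add: ennreal_mult[symmetric])
  also have "\<dots> = (\<Sum>n. hausdorff_content m \<delta> (A n)) + e"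
    unfolding ennreal_suminf_cmult
    by (subst suminf_ennreal_eq[OF zero_le_power power_half_series]) auto
  finally show "hausdorff_content m \<delta> (\<Union>i. A i) \<le> (\<Sum>i. hausdorff_content m \<delta> (A i)) + e" .
qed

lemma hausdorff_outer_countably_subadditive:
  fixes A :: "nat \<Rightarrow> 'a::metric_space set"
  shows "hausdorff_outer m (\<Union>i. A i) \<le> (\<Sum>i. hausdorff_outer m (A i))"
  unfolding hausdorff_outer_def[of m "\<Union>i. A i"]
proof (rule SUP_least)
  fix \<delta> :: real assume "\<delta> \<in> {0<..}"
  then show "hausdorff_content m \<delta> (\<Union>i. A i) \<le> (\<Sum>i. hausdorff_outer m (A i))"
    by (intro order_trans[OF hausdorff_content_countably_subadditive] suminf_le)
       (auto intro: hausdorff_content_le_outer)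
qed

lemma outer_measure_space_hausdorff_outer: "outer_measure_space (Pow UNIV) (hausdorff_outer m)"
  by (auto simp: outer_measure_space_def positive_def increasing_def countably_subadditive_def
      intro: hausdorff_outer_mono hausdorff_outer_countably_subadditive)

lemma hausdorff_outer_Un_le: "hausdorff_outer m (A \<union> B) \<le> hausdorff_outer m A + hausdorff_outer m B"
proof -
  have "hausdorff_outer m (\<Union>i. binaryset A B i) \<le> (\<Sum>i. hausdorff_outer m (binaryset A B i))"
    by (rule hausdorff_outer_countably_subadditive)
  then show ?thesis
    by (simp add: UN_binaryset_eq suminf_binaryset_eq)
qed

lemma hausdorff_outer_separated:
  fixes A B :: "'a::metric_space set"
  assumes "0 < e" and sep: "\<And>x y. x \<in> A \<Longrightarrow> y \<in> B \<Longrightarrow> e \<le> dist x y"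
  shows "hausdorff_outer m A + hausdorff_outer m B \<le> hausdorff_outer m (A \<union> B)"
proof -
  have *: "hausdorff_content m \<delta> A + hausdorff_content m \<delta> B \<le> hausdorff_content m \<delta> (A \<union> B)"
    if "\<delta> < e" for \<delta>
    unfolding hausdorff_content_def[of m \<delta> "A \<union> B"]
  proof (rule INF_greatest, safe)
    fix U :: "nat \<Rightarrow> 'a set"
    assume U: "A \<union> B \<subseteq> (\<Union>i. U i)" "\<forall>i. bounded (U i) \<and> diameter (U i) \<le> \<delta>"
    define V where "V i = (if U i \<inter> A = {} then {} else U i)" for i
    define W where "W i = (if U i \<inter> B = {} then {} else U i)" for i
    have "0 \<le> \<delta>"
      using U(2) diameter_ge_0 order_trans by blast
    have 1: "hausdorff_content m \<delta> A \<le> (\<Sum>i. hausdorff_gauge m (V i))"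
      unfolding hausdorff_content_def
      using U \<open>0 \<le> \<delta>\<close> by (intro INF_lower) (auto simp: V_def subset_eq, blast+)
    have 2: "hausdorff_content m \<delta> B \<le> (\<Sum>i. hausdorff_gauge m (W i))"
      unfolding hausdorff_content_def
      using U \<open>0 \<le> \<delta>\<close> by (intro INF_lower) (auto simp: W_def subset_eq, blast+)
    have "hausdorff_gauge m (V i) + hausdorff_gauge m (W i) \<le> hausdorff_gauge m (U i)" for i
    proof (cases "U i \<inter> A = {} \<or> U i \<inter> B = {}")
      case True
      then show ?thesis by (auto simp: V_def W_def hausdorff_gauge_def)
    next
      case False
      then obtain x y where "x \<in> U i" "x \<in> A" "y \<in> U i" "y \<in> B" by blast
      then have "e \<le> \<delta>"
        using sep[of x y] diameter_bounded_bound[of "U i" x y] U(2) by (meson order_trans)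
      with that show ?thesis by simp
    qed
    then have "(\<Sum>i. hausdorff_gauge m (V i) + hausdorff_gauge m (W i)) \<le> (\<Sum>i. hausdorff_gauge m (U i))"
      by (intro suminf_le) auto
    then show "hausdorff_content m \<delta> A + hausdorff_content m \<delta> B \<le> (\<Sum>i. hausdorff_gauge m (U i))"
      using add_mono[OF 1 2] by (simp add: suminf_add[symmetric])
  qed
  have "hausdorff_content m d A + hausdorff_content m d' B \<le> hausdorff_outer m (A \<union> B)"
    if "0 < d" "0 < d'" for d d'
  proof -
    define \<delta> where "\<delta> = min (e / 2) (min d d')"
    have \<delta>: "0 < \<delta>" "\<delta> < e" "\<delta> \<le> d" "\<delta> \<le> d'"
      using that \<open>0 < e\<close> by (auto simp: \<delta>_def min_def)
    have "hausdorff_content m d A + hausdorff_content m d' B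
        \<le> hausdorff_content m \<delta> A + hausdorff_content m \<delta> B"
      using \<delta> by (intro add_mono hausdorff_content_antimono)
    also have "\<dots> \<le> hausdorff_outer m (A \<union> B)"
      using *[OF \<delta>(2)] hausdorff_content_le_outer[OF \<delta>(1)] order_trans by blast
    finally show ?thesis .
  qed
  then have "hausdorff_content m d A + hausdorff_outer m B \<le> hausdorff_outer m (A \<union> B)" if "0 < d" for d
    unfolding hausdorff_outer_def[of m B] using that
    by (subst ennreal_SUP_add_right) (auto intro!: SUP_least)
  then show ?thesis
    unfolding hausdorff_outer_def[of m A]
    by (subst ennreal_SUP_add_left[symmetric]) (auto intro!: SUP_least)
qed

lemma hausdorff_outer_closed_split:
  fixes A F :: "'a::metric_space set"
  assumes "closed F"
  shows "hausdorff_outer m (A \<inter> F) + hausdorff_outer m (A - F) = hausdorff_outer m A"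
proof (cases "F = {} \<or> hausdorff_outer m A = top")
  case True
  have "hausdorff_outer m A \<le> hausdorff_outer m (A \<inter> F) + hausdorff_outer m (A - F)"
    using hausdorff_outer_Un_le[of m "A \<inter> F" "A - F"] by (simp add: Int_Diff_Un)
  with True show ?thesis
    by (auto simp: top_unique)
next
  case False
  then have "F \<noteq> {}" and finA: "hausdorff_outer m A \<noteq> top" by auto
  define D where "D k = {x \<in> A. 1 / real (k + 1) \<le> infdist x F}" for k
  define R where "R k = {x \<in> A. 1 / real (k + 2) \<le> infdist x F \<and> infdist x F < 1 / real (k + 1)}" for k
  define f where "f k = hausdorff_outer m (R k)" for k
  have sep: "s - t \<le> dist x y" if "s \<le> infdist x F" "infdist y F \<le> t" for s t x y
    using infdist_triangle[of x F y] that by linarith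

  have far: "hausdorff_outer m (A \<inter> F) + hausdorff_outer m (D k) \<le> hausdorff_outer m A" for k
  proof -
    have "hausdorff_outer m (D k) + hausdorff_outer m (A \<inter> F) \<le> hausdorff_outer m (D k \<union> A \<inter> F)"
      by (rule hausdorff_outer_separated[of "1 / real (k + 1) - 0"], simp, rule sep) (auto simp: D_def)
    also have "\<dots> \<le> hausdorff_outer m A"
      by (rule hausdorff_outer_mono) (auto simp: D_def)
    finally show ?thesis by (simp add: add.commute)
  qed

  have shells: "(\<Sum>j<N. f (2 * j + p)) \<le> hausdorff_outer m (\<Union>j<N. R (2 * j + p))" for N p
  proof (induction N)
    case (Suc N)
    let ?s = "1 / real (2 * N + p)" and ?t = "1 / real (2 * N + p + 1)"
    have "(\<Sum>j<Suc N. f (2 * j + p))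
        \<le> hausdorff_outer m (\<Union>j<N. R (2 * j + p)) + hausdorff_outer m (R (2 * N + p))"
      using Suc.IH by (simp add: f_def add_right_mono)
    also have "\<dots> \<le> hausdorff_outer m ((\<Union>j<N. R (2 * j + p)) \<union> R (2 * N + p))"
    proof (cases "N = 0")
      case False
      then have "?t < ?s"
        by (intro divide_strict_left_mono) auto
      then have "0 < ?s - ?t" by simp
      moreover have "?s - ?t \<le> dist x y" if x: "x \<in> (\<Union>j<N. R (2 * j + p))" and y: "y \<in> R (2 * N + p)" for x y
      proof (rule sep)
        obtain j where "j < N" "x \<in> R (2 * j + p)"
          using x by blast
        then have "1 / real (2 * j + p + 2) \<le> infdist x F"
          by (simp add: R_def)
        moreover from \<open>j < N\<close> have "?s \<le> 1 / real (2 * j + p + 2)"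
          by (intro divide_left_mono) auto
        ultimately show "?s \<le> infdist x F" by linarith
        show "infdist y F \<le> ?t"
          using y by (simp add: R_def)
      qed
      ultimately show ?thesis
        by (rule hausdorff_outer_separated)
    qed simp
    finally show ?case by (simp add: lessThan_Suc Un_commute)
  qed simp
  have "(\<Sum>j<N. f j) \<le> 2 * hausdorff_outer m A" for N
  proof -
    have "(\<Sum>j<N. f j) \<le> (\<Sum>j<2 * N. f j)"
      by (rule sum_mono2) auto
    also have "\<dots> = (\<Sum>j<N. f (2 * j + 0)) + (\<Sum>j<N. f (2 * j + 1))"
      by (induction N) (auto simp: ac_simps)
    also have "\<dots> \<le> hausdorff_outer m A + hausdorff_outer m A"
      by (intro add_mono order_trans[OF shells] hausdorff_outer_mono) (auto simp: R_def)
    finally show ?thesis by (simp add: mult_2)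
  qed
  then have "(\<Sum>j. f j) \<le> 2 * hausdorff_outer m A"
    by (simp add: suminf_eq_SUP SUP_least)
  moreover have "2 * hausdorff_outer m A < top"
    using finA by (simp add: ennreal_mult_less_top less_top)
  ultimately have fin: "(\<Sum>j. f j) \<noteq> top"
    by (auto simp: top_unique)

  have "hausdorff_outer m (A \<inter> F) + hausdorff_outer m (A - F) \<le> hausdorff_outer m A"
  proof (rule ennreal_le_epsilon)
    fix e :: real assume "0 < e"
    have "(\<Sum>j. f j) < (\<Sum>j. f j) + e"
      using fin \<open>0 < e\<close> by (simp add: less_top ennreal_add_left_cancel_less)
    have "\<exists>k. (\<Sum>j. f j) < (\<Sum>j<k. f j) + e"
      using \<open>(\<Sum>j. f j) < (\<Sum>j. f j) + e\<close>
      unfolding suminf_eq_SUP[of f] by (subst (asm) ennreal_SUP_add_left[symmetric]) (auto simp: less_SUP_iff)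
    then obtain k where k: "(\<Sum>j. f j) < (\<Sum>j<k. f j) + e" ..
    have split: "(\<Sum>j<k. f j) + (\<Sum>j. f (j + k)) = (\<Sum>j. f j)"
      by (metis add.commute suminf_offset summableI)
    have "(\<Sum>j<k. f j) \<noteq> top"
      using fin split by (metis ennreal_add_eq_top)
    moreover have "(\<Sum>j<k. f j) + (\<Sum>j. f (j + k)) \<le> (\<Sum>j<k. f j) + e"
      using k unfolding split by (rule less_imp_le)
    ultimately have tail: "(\<Sum>j. f (j + k)) \<le> e"
      by (simp add: ennreal_add_left_cancel_le)
    have "x \<in> D k \<union> (\<Union>j. R (j + k))" if xA: "x \<in> A - F" for x
    proof (rule ccontr)
      assume x: "x \<notin> D k \<union> (\<Union>j. R (j + k))"
      have near: "infdist x F < 1 / real (j + k + 1)" for j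
      proof (induction j)
        case 0
        show ?case using x xA by (simp add: D_def not_le)
      next
        case (Suc j)
        have "x \<notin> R (j + k)" using x by blast
        with Suc xA show ?case by (simp add: R_def not_le add_ac)
      qed
      have "infdist x F \<noteq> 0"
        using in_closed_iff_infdist_zero[OF assms \<open>F \<noteq> {}\<close>] xA by blast
      then have "0 < infdist x F"
        using infdist_nonneg[of x F] by linarith
      then obtain n where n: "inverse (real (Suc n)) < infdist x F"
        using reals_Archimedean by blast
      have "1 / real (n + k + 1) \<le> 1 / real (Suc n)"
        by (intro divide_left_mono) auto
      with near[of n] n show False
        by (simp add: inverse_eq_divide)
    qed
    then have "hausdorff_outer m (A - F) \<le> hausdorff_outer m (D k \<union> (\<Union>j. R (j + k)))"
      by (intro hausdorff_outer_mono) blast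
    also have "\<dots> \<le> hausdorff_outer m (D k) + (\<Sum>j. f (j + k))"
      unfolding f_def
      by (intro order_trans[OF hausdorff_outer_Un_le] add_left_mono hausdorff_outer_countably_subadditive)
    also have "\<dots> \<le> hausdorff_outer m (D k) + e"
      using tail by (rule add_left_mono)
    finally have "hausdorff_outer m (A \<inter> F) + hausdorff_outer m (A - F)
        \<le> hausdorff_outer m (A \<inter> F) + hausdorff_outer m (D k) + e"
      by (simp add: add_left_mono add.assoc)
    also have "\<dots> \<le> hausdorff_outer m A + e"
      using far by (rule add_right_mono)
    finally show "hausdorff_outer m (A \<inter> F) + hausdorff_outer m (A - F) \<le> hausdorff_outer m A + e" .
  qed
  moreover have "hausdorff_outer m A \<le> hausdorff_outer m (A \<inter> F) + hausdorff_outer m (A - F)"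
    using hausdorff_outer_Un_le[of m "A \<inter> F" "A - F"] by (simp add: Int_Diff_Un)
  ultimately show ?thesis by (rule antisym)
qed

lemma space_hausdorff_measure [simp]: "space (hausdorff_measure m) = UNIV"
  by (simp add: hausdorff_measure_def)

lemma sets_hausdorff_measure [simp, measurable_cong]: "sets (hausdorff_measure m) = sets borel"
  unfolding hausdorff_measure_def using sets.sets_measure_of_eq[of borel] by simp

theorem emeasure_hausdorff_measure:
  assumes "A \<in> sets borel"
  shows "emeasure (hausdorff_measure m) A = hausdorff_outer m A"
proof -
  let ?L = "lambda_system UNIV (Pow UNIV) (hausdorff_outer m) :: 'a set set"
  have ms: "measure_space UNIV ?L (hausdorff_outer m)"
    by (rule sigma_algebra.caratheodory_lemma[OF sigma_algebra_Pow outer_measure_space_hausdorff_outer])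
  then have sa: "sigma_algebra UNIV ?L"
    by (simp add: measure_space_def)
  have "F \<in> ?L" if "closed F" for F :: "'a set"
    using hausdorff_outer_closed_split[OF that, of m] by (simp add: lambda_system_def Int_commute flip: Diff_eq Compl_eq_Diff_UNIV)
  then have "sigma_sets UNIV (Collect closed) \<subseteq> ?L"
    by (intro sigma_algebra.sigma_sets_subset[OF sa]) auto
  then have "sets borel \<subseteq> ?L"
    unfolding borel_eq_closed by (subst sets_measure_of) auto
  moreover have "sigma_algebra UNIV (sets borel :: 'a set set)"
    using sets.sigma_algebra_axioms[of "borel :: 'a measure"] by simp
  ultimately have "measure_space UNIV (sets borel) (hausdorff_outer m :: 'a set \<Rightarrow> _)"
    using measure_down[OF ms] by blast
  then show ?thesis
    using assms unfolding hausdorff_measure_def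
    by (intro emeasure_measure_of_sigma) (auto simp: measure_space_def)
qed


section \<open>Rectifiable sets\<close>

text \<open>
  Finite area, and up to a set of measure zero covered by countably many Lipschitz images of
  \<open>\<real>\<^sup>m\<close>, which is realised here as an \<open>m\<close>-dimensional linear subspace \<open>W\<close> of the ambient space.
\<close>

definition rectifiable :: "nat \<Rightarrow> 'a::euclidean_space set \<Rightarrow> bool" where
  "rectifiable m S \<longleftrightarrow>
     hausdorff_outer m S < \<infinity> \<and>
     (\<exists>W (f :: nat \<Rightarrow> 'a \<Rightarrow> 'a).
        subspace W \<and> dim W = m \<and> (\<forall>i. \<exists>C. C-lipschitz_on W (f i)) \<and>
        hausdorff_outer m (S - (\<Union>i. f i ` W)) = 0)"


section \<open>Submanifolds of full dimension and their boundary\<close>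

definition half_space :: "'a::euclidean_space \<Rightarrow> 'a set" where
  "half_space b = {x. 0 \<le> x \<bullet> b}"

text \<open>
  \<open>\<phi>\<close> maps a relatively open neighbourhood of \<open>p\<close> in \<open>K\<close> homeomorphically onto a relatively open
  subset of the half-space given by the coordinate vector \<open>b\<close>. No smoothness is required.
\<close>

definition chart_at :: "'a::euclidean_space set \<Rightarrow> 'a \<Rightarrow> 'a \<Rightarrow> ('a \<Rightarrow> 'a) \<Rightarrow> bool" where
  "chart_at K p b \<phi> \<longleftrightarrow>
     b \<in> Basis \<and>
     (\<exists>U V \<psi>. openin (top_of_set K) U \<and> p \<in> U \<and> openin (top_of_set (half_space b)) V \<and>
        homeomorphism U V \<phi> \<psi>)"

definition full_dim_submanifold :: "'a::euclidean_space set \<Rightarrow> bool" where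
  "full_dim_submanifold K \<longleftrightarrow> (\<forall>p\<in>K. \<exists>b \<phi>. chart_at K p b \<phi>)"

definition manifold_boundary :: "'a::euclidean_space set \<Rightarrow> 'a set" where
  "manifold_boundary K = {p \<in> K. \<exists>b \<phi>. chart_at K p b \<phi> \<and> \<phi> p \<bullet> b = 0}"

lemma manifold_boundary_eq_frontier:
  assumes "closed K" "full_dim_submanifold K"
  shows "manifold_boundary K = frontier K"
proof (intro set_eqI iffI)
  fix p assume "p \<in> manifold_boundary K"
  then obtain b \<phi> where p: "p \<in> K" "\<phi> p \<bullet> b = 0" and ch: "chart_at K p b \<phi>"
    unfolding manifold_boundary_def by blast
  then obtain U V \<psi> where "b \<in> Basis" "p \<in> U"
    and U: "openin (top_of_set K) U" and V: "openin (top_of_set (half_space b)) V"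
    and hom: "homeomorphism U V \<phi> \<psi>"
    unfolding chart_at_def by blast
  have "p \<notin> interior K"
  proof
    assume "p \<in> interior K"
    obtain T where T: "open T" "U = K \<inter> T"
      using U by (auto simp: openin_open)
    let ?W = "interior K \<inter> T"
    have "?W \<subseteq> U"
      using T(2) interior_subset by blast
    moreover have "open ?W"
      using T(1) by (intro open_Int open_interior)
    moreover have "inj_on \<phi> U"
      using hom by (intro inj_on_inverseI[of U \<psi>]) (simp add: homeomorphism_def)
    ultimately have "open (\<phi> ` ?W)"
      using homeomorphism_cont1[OF hom]
      by (meson invariance_of_domain continuous_on_subset inj_on_subset)
    moreover have "\<phi> p \<in> \<phi> ` ?W"
      using \<open>p \<in> interior K\<close> \<open>p \<in> U\<close> T(2) by blast
    ultimately obtain e where "0 < e" "ball (\<phi> p) e \<subseteq> \<phi> ` ?W"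
      using open_contains_ball by blast
    moreover have "\<phi> p - (e / 2) *\<^sub>R b \<in> ball (\<phi> p) e"
      using \<open>0 < e\<close> \<open>b \<in> Basis\<close> by (simp add: dist_norm)
    moreover have "\<phi> ` ?W \<subseteq> half_space b"
      using image_mono[OF \<open>?W \<subseteq> U\<close>, of \<phi>] homeomorphism_image1[OF hom] openin_imp_subset[OF V]
      by (metis order_trans)
    ultimately have "0 \<le> (\<phi> p - (e / 2) *\<^sub>R b) \<bullet> b"
      unfolding half_space_def by blast
    with p \<open>0 < e\<close> \<open>b \<in> Basis\<close> show False
      by (simp add: inner_diff_left inner_Basis)
  qed
  with \<open>p \<in> K\<close> show "p \<in> frontier K"
    by (simp add: frontier_def closure_closed[OF \<open>closed K\<close>])
next
  fix p assume fr: "p \<in> frontier K"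
  then have "p \<in> K" "p \<notin> interior K"
    by (auto simp: frontier_def closure_closed[OF \<open>closed K\<close>])
  then obtain b \<phi> where ch: "chart_at K p b \<phi>"
    using assms(2) unfolding full_dim_submanifold_def by blast
  then obtain U V \<psi> where p: "b \<in> Basis" "p \<in> U"
    and U: "openin (top_of_set K) U" and V: "openin (top_of_set (half_space b)) V"
    and hom: "homeomorphism U V \<phi> \<psi>"
    unfolding chart_at_def by blast
  have \<phi>p: "\<phi> p \<in> V" "\<psi> (\<phi> p) = p"
    using hom \<open>p \<in> U\<close> by (auto simp: homeomorphism_def)
  have "\<phi> p \<bullet> b = 0"
  proof (rule ccontr)
    assume "\<phi> p \<bullet> b \<noteq> 0"
    with \<phi>p V have pos: "0 < \<phi> p \<bullet> b"
      using openin_imp_subset by (fastforce simp: half_space_def)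
    obtain T where T: "open T" "V = half_space b \<inter> T"
      using V by (auto simp: openin_open)
    let ?W = "{x. 0 < x \<bullet> b} \<inter> T"
    have "?W \<subseteq> V"
      using T(2) by (auto simp: half_space_def)
    have "open {x. 0 < x \<bullet> b}"
      by (intro open_Collect_less continuous_intros)
    then have "open ?W"
      using T(1) by (rule open_Int)
    moreover have "inj_on \<psi> V"
      using hom by (intro inj_on_inverseI[of V \<phi>]) (simp add: homeomorphism_def)
    ultimately have "open (\<psi> ` ?W)"
      using \<open>?W \<subseteq> V\<close> homeomorphism_cont2[OF hom]
      by (meson invariance_of_domain continuous_on_subset inj_on_subset)
    moreover have "p \<in> \<psi> ` ?W"
      using \<phi>p pos T(2) by force
    moreover have "\<psi> ` ?W \<subseteq> K"
      using image_mono[OF \<open>?W \<subseteq> V\<close>, of \<psi>] homeomorphism_image2[OF hom] openin_imp_subset[OF U]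
      by (metis order_trans)
    ultimately show False
      using interiorI[of "\<psi> ` ?W" p K] \<open>p \<notin> interior K\<close> by blast
  qed
  with ch \<open>p \<in> K\<close> show "p \<in> manifold_boundary K"
    unfolding manifold_boundary_def by blast
qed


section \<open>Outward normals and weighted projected area\<close>

text \<open>
  The exterior normal in the sense of Federer: blowing up \<open>K\<close> at \<open>q\<close> gives the half-space
  \<open>{x. x \<bullet> n \<le> 0}\<close>. At points where the boundary has a classical tangent hyperplane with \<open>K\<close> on
  one side, this is the usual outward unit normal.
\<close>

definition outward_unit_normal :: "'a::euclidean_space set \<Rightarrow> 'a \<Rightarrow> 'a \<Rightarrow> bool" where
  "outward_unit_normal K q n \<longleftrightarrow>
     norm n = 1 \<and>
     ((\<lambda>r. measure lebesgue {x \<in> ball q r \<inter> K. 0 < (x - q) \<bullet> n} / r ^ DIM('a))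
        \<longlongrightarrow> 0) (at_right 0) \<and>
     ((\<lambda>r. measure lebesgue {x \<in> ball q r - K. (x - q) \<bullet> n < 0} / r ^ DIM('a))
        \<longlongrightarrow> 0) (at_right 0)"

definition weighted_projected_area ::
    "'a::euclidean_space set \<Rightarrow> ('a \<Rightarrow> 'a) \<Rightarrow> 'a \<Rightarrow> ennreal" where
  "weighted_projected_area S \<nu> v =
     1 / 2 * (\<integral>\<^sup>+ q\<in>S. ennreal \<bar>v \<bullet> \<nu> q\<bar> \<partial>hausdorff_measure (DIM('a) - 1))"

end

theory Submission
  imports Defs
begin

text \<open>
  Let \<open>\<pi>\<close> be the orthogonal projection onto \<open>v\<^sup>\<bottom>\<close> and \<open>H\<close> the \<open>(n - 1)\<close>-dimensional Hausdorff measure.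
  If exterior normals at two nearby points of \<open>\<Sigma>\<close> are attained up to the same small density on the
  same range of radii, then a chord with a large normal component would put a ball, of radius comparable
  to its length, into the union of two sets of small measure. Hence \<open>\<Sigma>\<close> splits, up to an \<open>H\<close>-null set,
  into countably many pieces whose chords are almost orthogonal to a fixed unit vector \<open>w\<close> and whose
  normals are close to \<open>w\<close>. On such a piece \<open>\<pi>\<close> is, up to a Lipschitz factor close to \<open>1\<close>, a rotation of \<open>w\<^sup>\<bottom>\<close> onto \<open>v\<^sup>\<bottom>\<close> followed by
  a stretch by the factor \<open>\<bar>v \<bullet> w\<bar>\<close> in one direction, which multiplies \<open>H\<close> by \<open>\<bar>v \<bullet> w\<bar>\<close>. Cutting a piece
  into thin slabs orthogonal to \<open>v\<close> turns these estimates for the area of \<open>\<pi>\<close>-images into estimates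
  for the number of intersections with lines parallel to \<open>v\<close>; summing over the pieces and letting the
  tolerance tend to \<open>0\<close> gives the identity.
\<close>

section \<open>Hausdorff measure and Lipschitz maps\<close>

text \<open>The field \<open>\<nu>\<close> carries no measurability assumption, so the pieces cannot
  be cut out by conditions on \<open>\<nu>\<close>. They are projections of compact sets of pairs
  (point, approximate normal), and the integral of \<open>\<bar>v \<bullet> \<nu> q\<bar>\<close> is
  only compared, by monotonicity, with Borel functions that are constant on each piece. The area of
  a hyperplane is never identified with Lebesgue measure: translation invariance, the Lipschitz
  bound and finiteness on bounded sets determine how \<open>H\<close> reacts to a stretch. Lebesgue
  measure occurs only in the density conditions that define a normal. The delicate pieces are those
  almost parallel to \<open>v\<close>, where the factor \<open>c = \<bar>v \<bullet> w\<bar>\<close>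
  is near 0 and the projection is far from bi-Lipschitz. With tolerance \<open>\<eta>\<close> in the
  factor the stretch may shrink vectors by \<open>\<eta>\<close>, so chords must be orthogonal to
  \<open>w\<close> up to order \<eta> squared. Pieces with \<open>c < \<eta>\<close> are estimated
  from above only; together they contribute at most a multiple of
  \<open>\<eta> * H(\<Sigma>)\<close>, which vanishes in the limit because
  \<open>H(\<Sigma>)\<close> is finite.\<close>

lemma ennreal_divide_le_imp:
  assumes "0 < c" "x / ennreal c \<le> y" shows "x \<le> ennreal c * y"
proof -
  have "x = x / ennreal c * ennreal c"
    using assms(1) by (simp add: ennreal_divide_times divide_ennreal ennreal_mult_divide_eq)
  also have "\<dots> \<le> y * ennreal c"
    using assms(2) by (rule mult_right_mono) simp
  finally show ?thesis by (simp add: mult.commute)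
qed

lemma diameter_le_metric:
  fixes S :: "'a::metric_space set"
  assumes "0 \<le> d" "\<And>x y. x \<in> S \<Longrightarrow> y \<in> S \<Longrightarrow> dist x y \<le> d"
  shows "diameter S \<le> d"
  using assms by (auto simp: diameter_def intro!: cSUP_least)

text \<open>A cover of \<open>A\<close> at scale \<open>\<delta> / L\<close>, cut down to
  \<open>A\<close> because \<open>f\<close> is controlled only there, is mapped to a cover at scale
  \<open>\<delta>\<close>, and each gauge grows by at most the factor \<open>L ^ m\<close>.\<close>

lemma hausdorff_outer_lipschitz_image:
  fixes f :: "'a::metric_space \<Rightarrow> 'b::metric_space"
  assumes "0 < L" and lip: "\<And>x y. x \<in> A \<Longrightarrow> y \<in> A \<Longrightarrow> dist (f x) (f y) \<le> L * dist x y"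
  shows "hausdorff_outer m (f ` A) \<le> ennreal (L ^ m) * hausdorff_outer m A"
  unfolding hausdorff_outer_def[of m "f ` A"]
proof (rule SUP_least)
  fix \<delta> :: real assume "\<delta> \<in> {0<..}"
  then have "0 < \<delta>" by simp
  have "hausdorff_content m \<delta> (f ` A) / ennreal (L ^ m) \<le> hausdorff_content m (\<delta> / L) A"
    unfolding hausdorff_content_def[of m "\<delta> / L"]
  proof (rule INF_greatest, safe)
    fix U :: "nat \<Rightarrow> 'a set"
    assume U: "A \<subseteq> (\<Union>i. U i)" "\<forall>i. bounded (U i) \<and> diameter (U i) \<le> \<delta> / L"
    have d: "dist y z \<le> L * diameter (U i)" if yz: "y \<in> f ` (U i \<inter> A)" "z \<in> f ` (U i \<inter> A)" for i y z
    proof -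
      obtain p q where pq: "p \<in> U i" "p \<in> A" "q \<in> U i" "q \<in> A" "y = f p" "z = f q"
        using yz by blast
      have "dist y z \<le> L * dist p q" using lip pq by blast
      also have "\<dots> \<le> L * diameter (U i)"
        using \<open>0 < L\<close> U(2) pq by (intro mult_left_mono diameter_bounded_bound) auto
      finally show ?thesis .
    qed
    have diam: "diameter (f ` (U i \<inter> A)) \<le> L * diameter (U i)" for i
      using \<open>0 < L\<close> d U(2) by (intro diameter_le_metric mult_nonneg_nonneg diameter_ge_0) auto
    have bnd: "bounded (f ` (U i \<inter> A))" for i
      using d unfolding bounded_two_points by blast
    have "hausdorff_content m \<delta> (f ` A) \<le> (\<Sum>i. hausdorff_gauge m (f ` (U i \<inter> A)))"
      unfolding hausdorff_content_def
    proof (rule INF_lower, safe)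
      fix x assume "x \<in> A" then show "f x \<in> (\<Union>i. f ` (U i \<inter> A))" using U(1) by blast
    next
      fix i
      have "diameter (f ` (U i \<inter> A)) \<le> L * (\<delta> / L)"
        using diam[of i] U(2) \<open>0 < L\<close> by (meson mult_left_mono less_imp_le order_trans)
      then show "diameter (f ` (U i \<inter> A)) \<le> \<delta>" using \<open>0 < L\<close> by simp
    qed (rule bnd)
    also have "\<dots> \<le> (\<Sum>i. ennreal (L ^ m) * hausdorff_gauge m (U i))"
    proof (rule suminf_le)
      fix i
      show "hausdorff_gauge m (f ` (U i \<inter> A)) \<le> ennreal (L ^ m) * hausdorff_gauge m (U i)"
      proof (cases "U i \<inter> A = {}")
        case False
        have "(diameter (f ` (U i \<inter> A)) / 2) ^ m \<le> (L * (diameter (U i) / 2)) ^ m"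
          using diam[of i] bnd[of i] by (intro power_mono) (auto intro: diameter_ge_0)
        then have "unit_ball_vol (real m) * (diameter (f ` (U i \<inter> A)) / 2) ^ m
            \<le> L ^ m * (unit_ball_vol (real m) * (diameter (U i) / 2) ^ m)"
          unfolding power_mult_distrib[of L]
          using mult_left_mono[of _ _ "unit_ball_vol (real m)"] by (simp only: mult.left_commute) simp
        with False \<open>0 < L\<close> show ?thesis
          using U(2) diameter_ge_0[of "U i"]
          by (auto simp: hausdorff_gauge_def intro!: ennreal_leI simp flip: ennreal_mult)
      qed (simp add: hausdorff_gauge_def)
    qed auto
    also have "\<dots> = ennreal (L ^ m) * (\<Sum>i. hausdorff_gauge m (U i))" by simp
    finally show "hausdorff_content m \<delta> (f ` A) / ennreal (L ^ m) \<le> (\<Sum>i. hausdorff_gauge m (U i))"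
      using \<open>0 < L\<close> by (intro divide_le_posI_ennreal) auto
  qed
  also have "\<dots> \<le> hausdorff_outer m A"
    using \<open>0 < L\<close> \<open>0 < \<delta>\<close> by (intro hausdorff_content_le_outer) simp
  finally show "hausdorff_content m \<delta> (f ` A) \<le> ennreal (L ^ m) * hausdorff_outer m A"
    using \<open>0 < L\<close> by (intro ennreal_divide_le_imp) auto
qed

text \<open>The hypothesis makes \<open>f\<close> constant on the fibres of \<open>g\<close>, so
  \<open>f\<close> factors through \<open>g\<close> by an \<open>L\<close>-Lipschitz map. This
  compares two images of one set without naming a map between them.\<close>

lemma hausdorff_outer_image_le_image:
  fixes f :: "'a \<Rightarrow> 'b::metric_space" and g :: "'a \<Rightarrow> 'c::metric_space"
  assumes "0 < L" and lip: "\<And>x y. x \<in> A \<Longrightarrow> y \<in> A \<Longrightarrow> dist (f x) (f y) \<le> L * dist (g x) (g y)"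
  shows "hausdorff_outer m (f ` A) \<le> ennreal (L ^ m) * hausdorff_outer m (g ` A)"
proof -
  let ?h = "\<lambda>z. f (inv_into A g z)"
  have "f x = ?h (g x)" if "x \<in> A" for x
  proof -
    have "inv_into A g (g x) \<in> A" "g (inv_into A g (g x)) = g x"
      using that by (auto intro: inv_into_into f_inv_into_f)
    then show ?thesis using lip[OF that, of "inv_into A g (g x)"] by simp
  qed
  then have "f ` A = ?h ` g ` A" by (simp add: image_image cong: image_cong_simp)
  moreover have "hausdorff_outer m (?h ` g ` A) \<le> ennreal (L ^ m) * hausdorff_outer m (g ` A)"
  proof (rule hausdorff_outer_lipschitz_image[OF \<open>0 < L\<close>])
    fix y z assume "y \<in> g ` A" "z \<in> g ` A"
    then show "dist (?h y) (?h z) \<le> L * dist y z"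
      using lip[of "inv_into A g y" "inv_into A g z"] by (simp add: inv_into_into f_inv_into_f)
  qed
  ultimately show ?thesis by simp
qed

lemma hausdorff_outer_isometry:
  fixes f :: "'a::metric_space \<Rightarrow> 'b::metric_space"
  assumes "\<And>x y. x \<in> A \<Longrightarrow> y \<in> A \<Longrightarrow> dist (f x) (f y) = dist x y"
  shows "hausdorff_outer m (f ` A) = hausdorff_outer m A"
  using hausdorff_outer_image_le_image[of 1 A f "\<lambda>x. x" m]
    hausdorff_outer_image_le_image[of 1 A "\<lambda>x. x" f m] assms
  by (intro antisym) auto

text \<open>The cover is padded to a sequence by empty sets, which cost nothing even for
  \<open>m = 0\<close> because the gauge of the empty set is 0 by convention.\<close>

lemma hausdorff_content_finite_cover:
  fixes C :: "'i \<Rightarrow> 'a::metric_space set"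
  assumes "finite I" "A \<subseteq> (\<Union>i\<in>I. C i)" "0 \<le> \<delta>"
    and C: "\<And>i. i \<in> I \<Longrightarrow> bounded (C i)" "\<And>i. i \<in> I \<Longrightarrow> diameter (C i) \<le> \<delta>"
  shows "hausdorff_content m \<delta> A \<le> (\<Sum>i\<in>I. hausdorff_gauge m (C i))"
proof -
  obtain h where h: "bij_betw h {0..<card I} I"
    using ex_bij_betw_nat_finite[OF \<open>finite I\<close>] by blast
  define U where "U k = (if k < card I then C (h k) else {})" for k
  have hI: "h k \<in> I" if "k < card I" for k
    using h that by (auto simp: bij_betw_def)
  have "(\<Union>i\<in>I. C i) = (\<Union>k<card I. C (h k))"
    using h by (simp add: bij_betw_imp_surj_on atLeast0LessThan flip: image_image)
  then have "A \<subseteq> (\<Union>k. U k)"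
    using assms(2) unfolding U_def by fastforce
  then have "hausdorff_content m \<delta> A \<le> (\<Sum>k. hausdorff_gauge m (U k))"
    unfolding hausdorff_content_def using C hI \<open>0 \<le> \<delta>\<close>
    by (intro INF_lower) (auto simp: U_def)
  also have "\<dots> = (\<Sum>k<card I. hausdorff_gauge m (U k))"
    by (intro suminf_finite) (auto simp: U_def hausdorff_gauge_def)
  also have "\<dots> = (\<Sum>k\<in>{0..<card I}. hausdorff_gauge m (C (h k)))"
    by (simp add: U_def atLeast0LessThan)
  also have "\<dots> = (\<Sum>i\<in>I. hausdorff_gauge m (C i))"
    by (rule sum.reindex_bij_betw[OF h])
  finally show ?thesis .
qed

text \<open>The projection of a Borel null set need not be Borel, so it has to be enclosed in a
  Borel one. Fine covers with total gauge below \<open>1 / Suc k\<close> are replaced by their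
  closures, which have the same diameters, and intersected over \<open>k\<close>.\<close>

lemma hausdorff_outer_null_imp_null_set:
  fixes A :: "'a::euclidean_space set"
  assumes "hausdorff_outer m A = 0"
  obtains B where "A \<subseteq> B" "B \<in> null_sets (hausdorff_measure m)"
proof -
  have "\<exists>U. A \<subseteq> (\<Union>i. U i) \<and> (\<forall>i. bounded (U i) \<and> diameter (U i) \<le> 1 / real (Suc k)) \<and>
      (\<Sum>i. hausdorff_gauge m (U i)) < ennreal (1 / real (Suc k))" for k
  proof -
    have "hausdorff_content m (1 / real (Suc k)) A \<le> hausdorff_outer m A"
      by (rule hausdorff_content_le_outer) simp
    then have "hausdorff_content m (1 / real (Suc k)) A < ennreal (1 / real (Suc k))"
      using assms by simp
    then show ?thesis unfolding hausdorff_content_def INF_less_iff by auto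
  qed
  then obtain U where U: "\<And>k. A \<subseteq> (\<Union>i. U k i)" "\<And>k i. bounded (U k i)"
      "\<And>k i. diameter (U k i) \<le> 1 / real (Suc k)"
      "\<And>k. (\<Sum>i. hausdorff_gauge m (U k i)) < ennreal (1 / real (Suc k))"
    by metis
  define B where "B = (\<Inter>k. \<Union>i. closure (U k i))"
  have B: "B \<in> sets borel" unfolding B_def by measurable
  have "(\<Union>i. U k i) \<subseteq> (\<Union>i. closure (U k i))" for k
    by (intro UN_mono closure_subset) auto
  then have "A \<subseteq> B"
    unfolding B_def using U(1) by (intro INT_greatest) (meson order_trans)
  have le: "hausdorff_content m (1 / real (Suc k)) B \<le> ennreal (1 / real (Suc k))" for k
  proof -
    have "hausdorff_content m (1 / real (Suc k)) B \<le> (\<Sum>i. hausdorff_gauge m (closure (U k i)))"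
      unfolding hausdorff_content_def B_def using U(2,3)
      by (intro INF_lower) (auto simp: diameter_closure)
    also have "\<dots> = (\<Sum>i. hausdorff_gauge m (U k i))"
      using U(2) by (simp add: hausdorff_gauge_def diameter_closure cong: if_cong)
    finally show ?thesis using U(4)[of k] by simp
  qed
  have "hausdorff_outer m B \<le> 0"
    unfolding hausdorff_outer_def
  proof (rule SUP_least)
    fix \<delta> :: real assume "\<delta> \<in> {0<..}"
    show "hausdorff_content m \<delta> B \<le> 0"
    proof (rule ennreal_le_epsilon)
      fix e :: real assume "0 < e"
      obtain k where k: "inverse (real (Suc k)) < min \<delta> e"
        using reals_Archimedean[of "min \<delta> e"] \<open>0 < e\<close> \<open>\<delta> \<in> {0<..}\<close> by auto
      have "hausdorff_content m \<delta> B \<le> hausdorff_content m (1 / real (Suc k)) B"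
        using k by (intro hausdorff_content_antimono) (simp add: inverse_eq_divide)
      also have "\<dots> \<le> ennreal (1 / real (Suc k))" by (rule le)
      also have "\<dots> \<le> e" using k by (intro ennreal_leI) (simp add: inverse_eq_divide)
      finally show "hausdorff_content m \<delta> B \<le> 0 + ennreal e" by simp
    qed
  qed
  then have "B \<in> null_sets (hausdorff_measure m)"
    using B by (auto simp: null_sets_def emeasure_hausdorff_measure)
  with \<open>A \<subseteq> B\<close> that show thesis by blast
qed

text \<open>In orthonormal coordinates a cube around \<open>A\<close> is cut into
  \<open>k ^ m\<close> boxes with diameter of order \<open>1 / k\<close>, so the total gauge is
  bounded independently of \<open>k\<close>.\<close>

lemma hausdorff_outer_bounded_subspace:
  fixes V :: "'a::euclidean_space set"
  assumes "subspace V" "dim V = m" "A \<subseteq> V" "bounded A"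
  shows "hausdorff_outer m A < \<infinity>"
proof -
  obtain B where B: "B \<subseteq> V" "pairwise orthogonal B" "\<And>x. x \<in> B \<Longrightarrow> norm x = 1"
      "independent B" "card B = m" "span B = V"
    using orthonormal_basis_subspace[OF assms(1)] assms(2) by metis
  then have "finite B" using independent_imp_finite by blast
  obtain R where R: "0 < R" "\<And>x. x \<in> A \<Longrightarrow> norm x < R"
    using assms(4) by (meson bounded_pos_less)
  \<comment> \<open>Side length of the cube times the number of coordinates: the triangle inequality
    along the basis bounds the diameter of a box of side \<open>2 * R / k\<close> by
    \<open>D / k\<close>.\<close>
  define D where "D = real m * (2 * R)"
  define c where "c = unit_ball_vol (real m) * D ^ m"
  have "hausdorff_content m \<delta> A \<le> ennreal c" if "0 < \<delta>" for \<delta>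
  proof -
    obtain k :: nat where "max (D / \<delta>) 0 < real k"
      using reals_Archimedean2 by blast
    then have k: "D / \<delta> < real k" "0 < k" by auto
    then have Dk: "D / real k \<le> \<delta>" using \<open>0 < \<delta>\<close> by (simp add: field_simps)
    define I where "I = (B \<rightarrow>\<^sub>E {..<k})"
    define C where "C f = {x \<in> V. \<forall>b\<in>B. 2 * R * real (f b) / real k \<le> x \<bullet> b + R \<and>
        x \<bullet> b + R \<le> 2 * R * real (f b + 1) / real k}" for f
    have "finite I" unfolding I_def using \<open>finite B\<close> by (intro finite_PiE) auto
    have cover: "A \<subseteq> (\<Union>f\<in>I. C f)"
    proof
      fix x assume "x \<in> A"
      define f where "f = restrict (\<lambda>b. nat \<lfloor>(x \<bullet> b + R) * real k / (2 * R)\<rfloor>) B"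
      have *: "0 \<le> x \<bullet> b + R \<and> x \<bullet> b + R < 2 * R" if "b \<in> B" for b
        using Cauchy_Schwarz_ineq2[of x b] B(3)[OF that] R(2)[OF \<open>x \<in> A\<close>] by (auto simp: abs_le_iff)
      have **: "0 \<le> (x \<bullet> b + R) * real k / (2 * R) \<and> (x \<bullet> b + R) * real k / (2 * R) < real k"
        if "b \<in> B" for b
      proof -
        have "(x \<bullet> b + R) * real k < 2 * R * real k"
          using *[OF that] k(2) by (intro mult_strict_right_mono) auto
        then show ?thesis using *[OF that] R(1) k(2) by (simp add: divide_less_eq mult.commute)
      qed
      have "f \<in> I"
        using ** by (auto simp: f_def I_def floor_less_iff nat_less_iff)
      moreover have "x \<in> C f"
      proof -
        have "2 * R * real (f b) / real k \<le> x \<bullet> b + R \<and> x \<bullet> b + R \<le> 2 * R * real (f b + 1) / real k"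
          if "b \<in> B" for b
        proof -
          have "real (f b) = of_int \<lfloor>(x \<bullet> b + R) * real k / (2 * R)\<rfloor>"
            using **[OF that] that by (simp add: f_def)
          then have "real (f b) \<le> (x \<bullet> b + R) * real k / (2 * R)"
              "(x \<bullet> b + R) * real k / (2 * R) \<le> real (f b) + 1"
            by linarith+
          then have "real (f b) * (2 * R) \<le> (x \<bullet> b + R) * real k"
              "(x \<bullet> b + R) * real k \<le> (real (f b) + 1) * (2 * R)"
            using R(1) by (simp_all add: pos_le_divide_eq pos_divide_le_eq)
          then show ?thesis using k(2)
            by (simp add: pos_le_divide_eq pos_divide_le_eq ac_simps)
        qed
        then show ?thesis using \<open>x \<in> A\<close> assms(3) by (auto simp: C_def)
      qed
      ultimately show "x \<in> (\<Union>f\<in>I. C f)" by blast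
    qed
    have dist: "dist x y \<le> D / real k" if "x \<in> C f" "y \<in> C f" for x y f
    proof -
      have "x - y \<in> span B"
        using that assms(1) B(6) by (auto simp: C_def intro: subspace_diff)
      then have "norm (x - y) = norm (\<Sum>b\<in>B. ((x - y) \<bullet> b) *\<^sub>R b)"
        using orthonormal_basis_expand[OF B(2,3)] \<open>finite B\<close> by simp
      also have "\<dots> \<le> (\<Sum>b\<in>B. \<bar>(x - y) \<bullet> b\<bar>)"
        by (rule order_trans[OF norm_sum]) (simp add: B(3))
      also have "\<dots> \<le> (\<Sum>b\<in>B. 2 * R / real k)"
      proof (rule sum_mono)
        fix b assume "b \<in> B"
        let ?l = "2 * R * real (f b) / real k"
        have "2 * R * real (f b + 1) / real k = ?l + 2 * R / real k"
          by (simp add: add_divide_distrib distrib_left)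
        moreover have "?l \<le> x \<bullet> b + R" "?l \<le> y \<bullet> b + R"
            "x \<bullet> b + R \<le> 2 * R * real (f b + 1) / real k"
            "y \<bullet> b + R \<le> 2 * R * real (f b + 1) / real k"
          using that \<open>b \<in> B\<close> by (simp_all add: C_def)
        ultimately have "\<bar>x \<bullet> b - y \<bullet> b\<bar> \<le> 2 * R / real k" by linarith
        then show "\<bar>(x - y) \<bullet> b\<bar> \<le> 2 * R / real k" by (simp add: inner_diff_left)
      qed
      finally show ?thesis by (simp add: dist_norm D_def B(5))
    qed
    have "0 \<le> D / real k" using R(1) by (simp add: D_def)
    have bnd: "bounded (C f)" for f using dist unfolding bounded_two_points by blast
    have diam: "diameter (C f) \<le> D / real k" for f
      using dist \<open>0 \<le> D / real k\<close> by (intro diameter_le_metric) auto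
    have "hausdorff_content m \<delta> A \<le> (\<Sum>f\<in>I. hausdorff_gauge m (C f))"
      using \<open>finite I\<close> cover \<open>0 < \<delta>\<close> bnd diam Dk
      by (intro hausdorff_content_finite_cover) (auto intro: order_trans)
    also have "\<dots> \<le> (\<Sum>f\<in>I. ennreal (unit_ball_vol (real m) * (D / real k) ^ m))"
    proof (rule sum_mono)
      fix f
      have "diameter (C f) / 2 \<le> D / real k"
        using diam[of f] diameter_ge_0[OF bnd[of f]] by linarith
      then have "(diameter (C f) / 2) ^ m \<le> (D / real k) ^ m"
        using diameter_ge_0[OF bnd[of f]] by (intro power_mono) auto
      then show "hausdorff_gauge m (C f) \<le> ennreal (unit_ball_vol (real m) * (D / real k) ^ m)"
        by (auto simp: hausdorff_gauge_def intro!: ennreal_leI mult_left_mono)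
    qed
    also have "\<dots> = ennreal (real k ^ m * (unit_ball_vol (real m) * (D / real k) ^ m))"
      using \<open>finite B\<close> \<open>0 \<le> D / real k\<close>
      by (simp add: I_def card_PiE B(5) ennreal_mult ennreal_of_nat_eq_real_of_nat)
    also have "real k ^ m * (unit_ball_vol (real m) * (D / real k) ^ m) = c"
      using k(2) by (simp add: c_def power_divide)
    finally show ?thesis .
  qed
  then have "hausdorff_outer m A \<le> ennreal c"
    unfolding hausdorff_outer_def by (auto intro: SUP_least)
  then show ?thesis by (simp add: le_less_trans)
qed

section \<open>Stretching a hyperplane\<close>

text \<open>
  Uniqueness of Haar measure: integrate \<open>1\<^sub>A(x + y) 1\<^sub>B(y)\<close> in both orders.
\<close>

lemma translation_invariant_measures_proportional:
  fixes M N :: "'a::euclidean_space measure"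
  assumes "sigma_finite_measure M" "sigma_finite_measure N"
    and [measurable_cong]: "sets M = sets borel" "sets N = sets borel"
    and conc: "AE x in M. x \<in> V" "AE x in N. x \<in> V" and V: "subspace V"
    and invM: "\<And>x A. x \<in> V \<Longrightarrow> A \<in> sets borel \<Longrightarrow> emeasure M ((+) x -` A) = emeasure M A"
    and invN: "\<And>x A. x \<in> V \<Longrightarrow> A \<in> sets borel \<Longrightarrow> emeasure N ((+) x -` A) = emeasure N A"
    and [measurable]: "A \<in> sets borel" "B \<in> sets borel"
  shows "emeasure M A * emeasure N B = emeasure N A * emeasure M (uminus -` B)"
proof -
  interpret pair_sigma_finite M N
    using assms by (simp add: pair_sigma_finite_def)
  have sp: "space M = UNIV" "space N = UNIV"
    using sets_eq_imp_space_eq[of M borel] sets_eq_imp_space_eq[of N borel] assms by auto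
  have meas: "S \<in> sets M" "S \<in> sets N" if "S \<in> sets borel" for S using that assms by auto
  have int: "(\<integral>\<^sup>+x. indicator S x \<partial>M) = emeasure M S" "(\<integral>\<^sup>+x. indicator S x \<partial>N) = emeasure N S"
    if "S \<in> sets borel" for S using meas that by auto
  have borel_vimage: "f -` S \<in> sets borel" if "f \<in> borel_measurable borel" "S \<in> sets borel"
    for f :: "'a \<Rightarrow> 'a" and S using measurable_sets[OF that] by simp
  have "emeasure M A * emeasure N B = (\<integral>\<^sup>+y. emeasure M A * indicator B y \<partial>N)"
    by (simp add: nn_integral_cmult int)
  also have "\<dots> = (\<integral>\<^sup>+y. \<integral>\<^sup>+x. indicator A (x + y) * indicator B y \<partial>M \<partial>N)"
  proof (rule nn_integral_cong_AE, use conc(2) in eventually_elim)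
    case (elim y)
    have eq: "indicator A (x + y) = (indicator ((+) y -` A) x :: ennreal)" for x
      by (simp add: indicator_def add.commute)
    have "(+) y -` A \<in> sets borel" by (auto intro!: borel_vimage)
    then have "(\<integral>\<^sup>+x. indicator A (x + y) * indicator B y \<partial>M)
        = (\<integral>\<^sup>+x. indicator ((+) y -` A) x \<partial>M) * indicator B y"
      unfolding eq by (subst nn_integral_multc) auto
    also have "\<dots> = emeasure M A * indicator B y"
      using elim by (subst int) (auto simp: invM intro!: borel_vimage)
    finally show ?case by simp
  qed
  also have "\<dots> = (\<integral>\<^sup>+x. \<integral>\<^sup>+y. indicator A (x + y) * indicator B y \<partial>N \<partial>M)"
    by (rule Fubini') measurable
  also have "\<dots> = (\<integral>\<^sup>+x. \<integral>\<^sup>+y. indicator A y * indicator B (y - x) \<partial>N \<partial>M)"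
  proof (rule nn_integral_cong_AE, use conc(1) in eventually_elim)
    case (elim x)
    let ?S = "A \<inter> (\<lambda>y. y - x) -` B"
    have S: "?S \<in> sets borel" by (auto intro!: borel_vimage)
    have "(\<integral>\<^sup>+y. indicator A (x + y) * indicator B y \<partial>N) = (\<integral>\<^sup>+y. indicator ((+) x -` ?S) y \<partial>N)"
      by (intro nn_integral_cong) (auto simp: indicator_def)
    also have "\<dots> = (\<integral>\<^sup>+y. indicator ?S y \<partial>N)"
    proof -
      have "(+) x -` ?S \<in> sets borel" using S by (rule borel_vimage[rotated]) simp
      then show ?thesis using elim S by (simp only: int invN)
    qed
    also have "\<dots> = (\<integral>\<^sup>+y. indicator A y * indicator B (y - x) \<partial>N)"
      by (intro nn_integral_cong) (auto simp: indicator_def)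
    finally show ?case .
  qed
  also have "\<dots> = (\<integral>\<^sup>+y. \<integral>\<^sup>+x. indicator A y * indicator B (y - x) \<partial>M \<partial>N)"
    by (rule Fubini'[symmetric]) measurable
  \<comment> \<open>For fixed \<open>y\<close> the points \<open>x\<close> with
    \<open>y - x \<in> B\<close> form a translate of the reflection of \<open>B\<close>; this is the
    origin of \<open>uminus\<close> in the conclusion.\<close>
  also have "\<dots> = (\<integral>\<^sup>+y. emeasure M (uminus -` B) * indicator A y \<partial>N)"
  proof (rule nn_integral_cong_AE, use conc(2) in eventually_elim)
    case (elim y)
    have eq: "indicator B (y - x) = (indicator ((+) (- y) -` uminus -` B) x :: ennreal)" for x
      by (simp add: indicator_def)
    have m: "uminus -` B \<in> sets borel" "(+) (- y) -` uminus -` B \<in> sets borel"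
      by (auto intro!: borel_vimage)
    have "(\<integral>\<^sup>+x. indicator A y * indicator B (y - x) \<partial>M)
        = indicator A y * (\<integral>\<^sup>+x. indicator ((+) (- y) -` uminus -` B) x \<partial>M)"
      unfolding eq using m by (subst nn_integral_cmult) auto
    also have "\<dots> = indicator A y * emeasure M (uminus -` B)"
      using elim V m by (subst int) (auto simp: invM subspace_neg)
    finally show ?case by (simp add: mult.commute)
  qed
  also have "\<dots> = emeasure M (uminus -` B) * (\<integral>\<^sup>+y. indicator A y \<partial>N)"
    by (rule nn_integral_cmult) measurable
  also have "\<dots> = emeasure N A * emeasure M (uminus -` B)"
    by (subst int) (simp_all add: mult.commute)
  finally show ?thesis .
qed

text \<open>Cauchy's functional equation: additivity gives the values at fractions, and
  nonnegativity makes \<open>g\<close> monotone, which squeezes \<open>g c\<close> between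
  neighbouring fractions.\<close>

lemma additive_nonneg_imp_linear:
  fixes g :: "real \<Rightarrow> real"
  assumes add: "\<And>s t. 0 < s \<Longrightarrow> 0 < t \<Longrightarrow> g (s + t) = g s + g t"
    and nonneg: "\<And>s. 0 < s \<Longrightarrow> 0 \<le> g s" and "0 < c"
  shows "g c = c * g 1"
proof -
  have mono: "g s \<le> g t" if "0 < s" "s \<le> t" for s t
    using add[of s "t - s"] nonneg[of "t - s"] that by (cases "s = t") auto
  have mult: "g (real (Suc k) * x) = real (Suc k) * g x" if "0 < x" for k x
  proof (induction k)
    case (Suc k)
    have "real (Suc (Suc k)) * x = real (Suc k) * x + x" by (simp add: algebra_simps)
    moreover have "g (real (Suc k) * x + x) = g (real (Suc k) * x) + g x"
      using that by (intro add) auto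
    moreover have "real (Suc (Suc k)) * g x = real (Suc k) * g x + g x" by (simp add: algebra_simps)
    ultimately show ?case using Suc by metis
  qed simp
  have frac: "g (real (Suc k) / real (Suc n)) = real (Suc k) / real (Suc n) * g 1" for k n
    using mult[of "1 / real (Suc n)" k] mult[of "1 / real (Suc n)" n] by (simp add: field_simps)
  have "\<bar>g c - c * g 1\<bar> \<le> g 1 / real (Suc n)" for n
  proof -
    define k where "k = nat \<lfloor>c * real (Suc n)\<rfloor>"
    have "real k = of_int \<lfloor>c * real (Suc n)\<rfloor>" using \<open>0 < c\<close> by (simp add: k_def)
    then have "real k \<le> c * real (Suc n)" "c * real (Suc n) \<le> real (Suc k)"
      by linarith+
    then have k: "real k / real (Suc n) \<le> c" "c \<le> real (Suc k) / real (Suc n)"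
      by (simp_all add: pos_le_divide_eq pos_divide_le_eq)
    have up: "g c \<le> real (Suc k) / real (Suc n) * g 1"
      using mono[OF \<open>0 < c\<close> k(2)] frac by simp
    \<comment> \<open>For \<open>k = 0\<close> monotonicity would need \<open>g\<close> at 0, where
      nothing is assumed; nonnegativity of \<open>g c\<close> does instead.\<close>
    have low: "real k / real (Suc n) * g 1 \<le> g c"
    proof (cases k)
      case (Suc j)
      then show ?thesis using mono[OF _ k(1)] frac[of j n] by simp
    qed (use nonneg \<open>0 < c\<close> in simp)
    have "real k / real (Suc n) * g 1 \<le> c * g 1" "c * g 1 \<le> real (Suc k) / real (Suc n) * g 1"
      using k nonneg[of 1] by (intro mult_right_mono; simp)+
    moreover have "real (Suc k) / real (Suc n) * g 1 = real k / real (Suc n) * g 1 + g 1 / real (Suc n)"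
      by (simp add: add_divide_distrib distrib_right del: of_nat_Suc) (simp add: add_divide_distrib distrib_right)
    ultimately show ?thesis using up low by linarith
  qed
  moreover have "(\<lambda>n. g 1 / real (Suc n)) \<longlonglongrightarrow> 0"
    using LIMSEQ_inverse_real_of_nat tendsto_mult_right_zero[of _ sequentially "g 1"]
    by (simp add: divide_inverse)
  ultimately have "\<bar>g c - c * g 1\<bar> \<le> 0"
    by (intro LIMSEQ_le_const[of "\<lambda>n. g 1 / real (Suc n)"]) auto
  then show ?thesis by simp
qed

lemma sigma_finite_measure_bounded:
  fixes M :: "'a::euclidean_space measure"
  assumes "sets M = sets borel" "\<And>A. bounded A \<Longrightarrow> A \<in> sets borel \<Longrightarrow> emeasure M A < \<infinity>"
  shows "sigma_finite_measure M"
proof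
  have "(\<Union>k. cball 0 (real k)) = (UNIV :: 'a set)"
    using real_arch_simple by auto
  then show "\<exists>A. countable A \<and> A \<subseteq> sets M \<and> \<Union> A = space M \<and> (\<forall>a\<in>A. emeasure M a \<noteq> \<infinity>)"
    using assms(2)[of "cball 0 _"] sets_eq_imp_space_eq[OF assms(1)] assms(1)
    by (intro exI[of _ "range (\<lambda>k. cball 0 (real k))"]) (auto simp: less_top)
qed

text \<open>
  The linear map that is the identity on \<open>b\<^sup>\<bottom>\<close> and multiplies the unit vector \<open>b\<close> by \<open>c\<close>.
\<close>

definition stretch :: "'a::real_inner \<Rightarrow> real \<Rightarrow> 'a \<Rightarrow> 'a" where
  "stretch b c x = x + ((c - 1) * (x \<bullet> b)) *\<^sub>R b"

lemma linear_stretch: "linear (stretch b c)"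
  by unfold_locales (auto simp: stretch_def inner_add_left algebra_simps)

lemma stretch_inner: "norm b = 1 \<Longrightarrow> stretch b c x \<bullet> b = c * (x \<bullet> b)"
  by (simp add: stretch_def inner_add_left norm_eq_1 algebra_simps)

lemma stretch_stretch: "norm b = 1 \<Longrightarrow> stretch b c (stretch b d x) = stretch b (c * d) x"
  by (simp add: stretch_def[of b c] stretch_inner) (simp add: stretch_def algebra_simps)

lemma stretch_1 [simp]: "stretch b 1 x = x"
  by (simp add: stretch_def)

lemma stretch_in_subspace: "subspace V \<Longrightarrow> b \<in> V \<Longrightarrow> x \<in> V \<Longrightarrow> stretch b c x \<in> V"
  by (simp add: stretch_def subspace_add subspace_scale)

text \<open>
  The measures \<open>A \<mapsto> H(A)\<close> and \<open>A \<mapsto> H(stretch b c A)\<close> on \<open>V\<close> are both translation invariant, hence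
  proportional. The factor is read off the slabs \<open>Q s\<close> of width \<open>s\<close> in direction \<open>b\<close>, whose measure is
  additive in \<open>s\<close>. If \<open>H(Q 1) = 0\<close>, then \<open>H(V) = 0\<close>.
\<close>

lemma hausdorff_outer_stretch:
  fixes V :: "'a::euclidean_space set"
  assumes V: "subspace V" "dim V = m" and b: "b \<in> V" "norm b = 1" and "0 < c"
    and A: "A \<subseteq> V" "A \<in> sets borel"
  shows "hausdorff_outer m (stretch b c ` A) = ennreal c * hausdorff_outer m A"
proof -
  let ?h = "hausdorff_outer m :: 'a set \<Rightarrow> _"
  let ?H = "hausdorff_measure m :: 'a measure"
  \<comment> \<open>Half-open in direction \<open>b\<close>, so that \<open>Q (s + t)\<close> is the
    disjoint union of \<open>Q s\<close> and a translate of \<open>Q t\<close>; the bounded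
    cross-section makes the measure finite.\<close>
  define Q where "Q s = {x \<in> V. 0 \<le> x \<bullet> b \<and> x \<bullet> b < s \<and> norm (x - (x \<bullet> b) *\<^sub>R b) \<le> 1}" for s
  define M where "M = density ?H (indicator V)"
  \<comment> \<open>Transport by the inverse stretch gives each subset of \<open>V\<close> the
    measure of its stretched image.\<close>
  define N where "N = distr M borel (stretch b (1 / c))"
  have bb: "b \<bullet> b = 1" using b by (simp add: norm_eq_1)
  have [measurable]: "V \<in> sets borel" using closed_subspace[OF V(1)] by simp
  have [measurable]: "stretch b d \<in> borel_measurable borel" for d :: real
    unfolding stretch_def[abs_def] by measurable
  have [measurable]: "Q s \<in> sets borel" for s unfolding Q_def by measurable
  have QV: "Q s \<subseteq> V" for s by (auto simp: Q_def)
  have eM: "emeasure M S = ?h (S \<inter> V)" if [measurable]: "S \<in> sets borel" for S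
  proof -
    have "emeasure M S = (\<integral>\<^sup>+x. indicator V x * indicator S x \<partial>?H)"
      unfolding M_def by (subst emeasure_density) auto
    also have "\<dots> = (\<integral>\<^sup>+x. indicator (S \<inter> V) x \<partial>?H)"
      by (intro nn_integral_cong) (simp split: split_indicator)
    finally show ?thesis by (simp add: emeasure_hausdorff_measure)
  qed
  have image_eq: "stretch b c ` S = stretch b (1 / c) -` S" for S
    using \<open>0 < c\<close> b(2) by (force simp: stretch_stretch)
  have vim: "stretch b (1 / c) -` S \<in> sets borel" if "S \<in> sets borel" for S
    using measurable_sets[OF _ that, of "stretch b (1 / c)" borel] by simp
  have stretchV: "stretch b d x \<in> V \<longleftrightarrow> x \<in> V" if "d \<noteq> 0" for d x
    using stretch_in_subspace[OF V(1) b(1), of "stretch b d x" "1 / d"]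
      stretch_in_subspace[OF V(1) b(1), of x d] that by (auto simp: stretch_stretch[OF b(2)])
  have eN: "emeasure N S = ?h (stretch b c ` (S \<inter> V))" if "S \<in> sets borel" for S
  proof -
    have "emeasure N S = emeasure M (stretch b (1 / c) -` S)"
      using that unfolding N_def by (subst emeasure_distr) (auto simp: M_def)
    also have "\<dots> = ?h (stretch b (1 / c) -` S \<inter> V)" using vim that by (simp add: eM)
    also have "stretch b (1 / c) -` S \<inter> V = stretch b (1 / c) -` (S \<inter> V)"
      using stretchV[of "1 / c"] \<open>0 < c\<close> by auto
    finally show ?thesis by (simp add: image_eq)
  qed
  have fin: "?h S < \<infinity>" if "bounded S" "S \<subseteq> V" for S
    by (rule hausdorff_outer_bounded_subspace[OF V(1,2) that(2,1)])
  have trans: "?h ((+) x ` S) = ?h S" for x S by (rule hausdorff_outer_isometry) simp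
  have trans': "?h ((+) x -` S) = ?h S" for x S
  proof -
    have "(+) x -` S = (+) (- x) ` S" by force
    then show ?thesis by (simp only: trans)
  qed
  have vtr: "(+) x -` S \<in> sets borel" if "S \<in> sets borel" for S and x :: 'a
    using measurable_sets[OF _ that, of "(+) x" borel] by simp
  have invM: "emeasure M ((+) x -` S) = emeasure M S" if "x \<in> V" "S \<in> sets borel" for x S
  proof -
    have "(+) x -` S \<inter> V = (+) x -` (S \<inter> V)"
      using that V(1) by (auto simp: subspace_add) (metis add_diff_cancel_left' subspace_diff)
    with that show ?thesis by (simp only: eM vtr trans')
  qed
  have invN: "emeasure N ((+) x -` S) = emeasure N S" if "x \<in> V" "S \<in> sets borel" for x S
  proof -
    have "(+) x -` S \<inter> V = (+) x -` (S \<inter> V)"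
      using that V(1) by (auto simp: subspace_add) (metis add_diff_cancel_left' subspace_diff)
    \<comment> \<open>By linearity a translation by \<open>x\<close> before the stretch is a
      translation by \<open>stretch b c x\<close> after it, and \<open>H\<close> is invariant under
      both.\<close>
    also have "stretch b (1 / c) -` \<dots> = (+) (stretch b c x) -` (stretch b (1 / c) -` (S \<inter> V))"
      using \<open>0 < c\<close> linear_add[OF linear_stretch[of b "1 / c"]] b(2) by (auto simp: stretch_stretch)
    finally show ?thesis using that by (simp only: eN vtr trans' image_eq)
  qed
  have sN: "sets N = sets borel" and sM: "sets M = sets borel" by (simp_all add: N_def M_def)
  have sf: "sigma_finite_measure M" "sigma_finite_measure N"
  proof (safe intro!: sigma_finite_measure_bounded sN sM)
    fix S :: "'a set" assume S: "bounded S" "S \<in> sets borel"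
    show "emeasure M S < \<infinity>" using S by (simp only: eM) (intro fin, auto intro: bounded_Int)
    have "bounded (stretch b c ` (S \<inter> V))"
      using S by (intro bounded_linear_image bounded_Int)
        (auto simp: linear_conv_bounded_linear[symmetric] linear_stretch)
    then show "emeasure N S < \<infinity>"
      using S V(1) b by (simp only: eN) (intro fin, auto intro: stretch_in_subspace)
  qed
  have conc: "AE x in M. x \<in> V" "AE x in N. x \<in> V"
    by (rule AE_I[of _ _ "- V"]; auto simp: eM eN sM sN)+
  have MN: "emeasure M A * emeasure N (Q 1) = emeasure N A * emeasure M (uminus -` Q 1)"
    by (rule translation_invariant_measures_proportional[OF sf sM sN conc V(1) invM invN]) (use A in auto)
  have Qfin: "?h (Q s) < \<infinity>" for s
  proof (intro fin QV)
    have "norm x \<le> 1 + \<bar>s\<bar>" if "x \<in> Q s" for x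
      using that norm_triangle_ineq[of "x - (x \<bullet> b) *\<^sub>R b" "(x \<bullet> b) *\<^sub>R b"] b(2) by (auto simp: Q_def)
    then show "bounded (Q s)" by (auto simp: bounded_iff)
  qed
  have Qadd: "?h (Q (s + t)) = ?h (Q s) + ?h (Q t)" if "0 < s" "0 < t" for s t
  proof -
    have sb: "s *\<^sub>R b \<in> V" using V(1) b(1) by (simp add: subspace_scale)
    have inn: "(s *\<^sub>R b + x) \<bullet> b = s + x \<bullet> b" for x by (simp add: inner_add_left bb)
    have "(+) (s *\<^sub>R b) ` Q t = {x \<in> V. s \<le> x \<bullet> b \<and> x \<bullet> b < s + t \<and> norm (x - (x \<bullet> b) *\<^sub>R b) \<le> 1}"
      (is "_ = ?T")
    proof safe
      fix x assume "x \<in> Q t"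
      then show "s *\<^sub>R b + x \<in> V" "s \<le> (s *\<^sub>R b + x) \<bullet> b" "(s *\<^sub>R b + x) \<bullet> b < s + t"
          "norm (s *\<^sub>R b + x - ((s *\<^sub>R b + x) \<bullet> b) *\<^sub>R b) \<le> 1"
        using sb V(1) unfolding inn by (auto simp: Q_def subspace_add algebra_simps)
    next
      fix x assume x: "x \<in> V" "s \<le> x \<bullet> b" "x \<bullet> b < s + t" "norm (x - (x \<bullet> b) *\<^sub>R b) \<le> 1"
      then have "x - s *\<^sub>R b \<in> Q t"
        using sb V(1) by (auto simp: Q_def subspace_diff inner_diff_left bb algebra_simps)
      then show "x \<in> (+) (s *\<^sub>R b) ` Q t" by (force intro: image_eqI[of _ _ "x - s *\<^sub>R b"])
    qed
    then have T: "?h ?T = ?h (Q t)" using trans[of "s *\<^sub>R b" "Q t"] by simp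
    have [measurable]: "?T \<in> sets borel" by measurable
    have "Q (s + t) = Q s \<union> ?T" "Q s \<inter> ?T = {}" using that by (auto simp: Q_def)
    then have "emeasure ?H (Q (s + t)) = emeasure ?H (Q s) + emeasure ?H ?T"
      by (simp add: plus_emeasure)
    then show ?thesis using T by (simp add: emeasure_hausdorff_measure)
  qed
  define q where "q = enn2real (?h (Q 1))"
  have q: "?h (Q 1) = ennreal q" using Qfin[of 1] by (simp add: q_def)
  have lin: "?h (Q s) = ennreal (s * q)" if "0 < s" for s
  proof -
    have "enn2real (?h (Q s)) = s * enn2real (?h (Q 1))"
    proof (rule additive_nonneg_imp_linear[OF _ _ that])
      fix s t :: real assume "0 < s" "0 < t"
      then show "enn2real (?h (Q (s + t))) = enn2real (?h (Q s)) + enn2real (?h (Q t))"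
        using Qfin by (simp add: Qadd enn2real_plus)
    qed simp
    then show ?thesis using Qfin[of s] unfolding q_def by (metis ennreal_enn2real infinity_ennreal_def)
  qed
  have "stretch b c ` Q 1 = Q c"
  proof -
    have "stretch b (1 / c) x - (stretch b (1 / c) x \<bullet> b) *\<^sub>R b = x - (x \<bullet> b) *\<^sub>R b" for x
      by (simp add: stretch_inner[OF b(2)]) (simp add: stretch_def algebra_simps)
    then show ?thesis
      unfolding image_eq using stretchV[of "1 / c"] \<open>0 < c\<close>
      by (auto simp: Q_def stretch_inner[OF b(2)] divide_less_eq zero_le_divide_iff)
  qed
  then have NQ: "emeasure N (Q 1) = ennreal (c * q)"
    using QV[of 1] lin[OF \<open>0 < c\<close>] by (simp add: eN Int_absorb2)
  \<comment> \<open>The reflection left over from the proportionality lemma is an isometry, so it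
    does not change the measure of the slab.\<close>
  have MQ: "emeasure M (uminus -` Q 1) = ennreal q"
  proof -
    have "uminus -` Q 1 = uminus ` Q 1" by force
    moreover have "uminus -` Q 1 \<inter> V = uminus -` Q 1"
      using V(1) QV[of 1] by auto (metis minus_minus subspace_neg subset_iff)
    moreover have "uminus -` Q 1 \<in> sets borel"
      using measurable_sets[of uminus borel borel "Q 1"] by simp
    ultimately show ?thesis
      using hausdorff_outer_isometry[of "Q 1" uminus m] by (simp add: eM q dist_minus)
  qed
  have eq: "?h A * ennreal (c * q) = ?h (stretch b c ` A) * ennreal q"
    using MN A by (simp add: NQ MQ eM eN Int_absorb2)
  show ?thesis
  proof (cases "q = 0")
    case False
    then have "0 < q" by (simp add: q_def order_less_le)
    then have "?h A * ennreal c * ennreal q = ?h (stretch b c ` A) * ennreal q"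
      using eq \<open>0 < c\<close> by (simp add: ennreal_mult mult.assoc)
    then show ?thesis using \<open>0 < q\<close> by (simp add: ennreal_mult_cancel_left mult.commute[of _ "ennreal q"] mult.commute[of "ennreal c"])
  next
    case True
    \<comment> \<open>Translated by \<open>b\<close>, the unit ball of \<open>V\<close> fits into
      the slab of width 2 and is therefore null; its dilations exhaust \<open>V\<close>.\<close>
    have "?h (V \<inter> ball 0 1) \<le> ?h ((+) (- b) ` Q 2)"
    proof (intro hausdorff_outer_mono subsetI)
      fix x assume x: "x \<in> V \<inter> ball 0 1"
      have "\<bar>x \<bullet> b\<bar> < 1" using Cauchy_Schwarz_ineq2[of x b] x b(2) by simp
      have "(norm (x - (x \<bullet> b) *\<^sub>R b))\<^sup>2 = (norm x)\<^sup>2 - (x \<bullet> b)\<^sup>2"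
        unfolding power2_norm_eq_inner
        by (simp add: inner_diff_left inner_diff_right bb inner_commute[of b x] power2_eq_square)
      then have "(norm (x - (x \<bullet> b) *\<^sub>R b))\<^sup>2 \<le> (norm x)\<^sup>2" by simp
      then have "norm (x - (x \<bullet> b) *\<^sub>R b) \<le> norm x" by (rule power2_le_imp_le) simp
      then have "b + x \<in> Q 2"
        using x b V(1) \<open>\<bar>x \<bullet> b\<bar> < 1\<close> by (auto simp: Q_def subspace_add inner_add_left bb algebra_simps)
      then show "x \<in> (+) (- b) ` Q 2" by (force intro: image_eqI[of _ _ "b + x"])
    qed
    then have z1: "?h (V \<inter> ball 0 1) = 0" unfolding trans using lin[of 2] True by simp
    have z: "?h (V \<inter> ball 0 (real (Suc k))) = 0" for k
    proof -
      have "V \<inter> ball 0 (real (Suc k)) \<subseteq> (*\<^sub>R) (real (Suc k)) ` (V \<inter> ball 0 1)"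
      proof
        fix x assume "x \<in> V \<inter> ball 0 (real (Suc k))"
        then have "(1 / real (Suc k)) *\<^sub>R x \<in> V \<inter> ball 0 1"
          using V(1) by (simp add: subspace_scale divide_less_eq)
        then show "x \<in> (*\<^sub>R) (real (Suc k)) ` (V \<inter> ball 0 1)"
          by (force intro: image_eqI[of _ _ "(1 / real (Suc k)) *\<^sub>R x"])
      qed
      then have "?h (V \<inter> ball 0 (real (Suc k))) \<le> ?h ((*\<^sub>R) (real (Suc k)) ` (V \<inter> ball 0 1))"
        by (rule hausdorff_outer_mono)
      also have "\<dots> \<le> ennreal (real (Suc k) ^ m) * ?h (V \<inter> ball 0 1)"
        by (intro hausdorff_outer_lipschitz_image) (auto simp: dist_norm simp flip: scaleR_diff_right)
      finally show ?thesis by (simp add: z1)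
    qed
    have "x \<in> (\<Union>k. V \<inter> ball 0 (real (Suc k)))" if "x \<in> V" for x
    proof -
      obtain k where "norm x < real k" using reals_Archimedean2 by blast
      with that show ?thesis by (auto intro!: exI[of _ k])
    qed
    then have "?h V \<le> ?h (\<Union>k. V \<inter> ball 0 (real (Suc k)))"
      by (intro hausdorff_outer_mono) auto
    also have "\<dots> \<le> (\<Sum>k. ?h (V \<inter> ball 0 (real (Suc k))))"
      by (rule hausdorff_outer_countably_subadditive)
    finally have "?h V = 0" by (simp only: z) simp
    then have "?h S = 0" if "S \<subseteq> V" for S
      using hausdorff_outer_mono[OF that, of m] by simp
    moreover have "stretch b c ` A \<subseteq> V" using A V(1) b(1) by (auto intro: stretch_in_subspace)
    ultimately show ?thesis using A(1) by simp
  qed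
qed

section \<open>Projections of flat sets\<close>

text \<open>
  Unlike Borel sets, these are stable under continuous images, so that projections stay measurable.
\<close>

definition sigma_compact :: "'a::topological_space set \<Rightarrow> bool" where
  "sigma_compact S \<longleftrightarrow> (\<exists>F :: nat \<Rightarrow> 'a set. (\<forall>n. compact (F n)) \<and> S = (\<Union>n. F n))"

lemma sigma_compact_borel [measurable_dest]:
  fixes S :: "'a::t2_space set"
  assumes "sigma_compact S" shows "S \<in> sets borel"
proof -
  obtain F :: "nat \<Rightarrow> 'a set" where "\<forall>n. compact (F n)" "S = (\<Union>n. F n)"
    using assms by (auto simp: sigma_compact_def)
  then show ?thesis by (auto intro: borel_compact)
qed

lemma sigma_compact_image:
  assumes "sigma_compact S" "continuous_on UNIV f" shows "sigma_compact (f ` S)"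
proof -
  obtain F :: "nat \<Rightarrow> 'a set" where "\<forall>n. compact (F n)" "S = (\<Union>n. F n)"
    using assms by (auto simp: sigma_compact_def)
  then show ?thesis
    unfolding sigma_compact_def using assms(2)
    by (intro exI[of _ "\<lambda>n. f ` F n"]) (auto intro: compact_continuous_image continuous_on_subset)
qed

lemma sigma_compact_Int:
  fixes S T :: "'a::t2_space set"
  assumes "sigma_compact S" "sigma_compact T" shows "sigma_compact (S \<inter> T)"
proof -
  obtain F G :: "nat \<Rightarrow> 'a set"
    where F: "\<forall>n. compact (F n)" "S = (\<Union>n. F n)" and G: "\<forall>n. compact (G n)" "T = (\<Union>n. G n)"
    using assms by (auto simp: sigma_compact_def)
  have "S \<inter> T = (\<Union>n. F (fst (prod_decode n)) \<inter> G (snd (prod_decode n)))"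
  proof safe
    fix x assume "x \<in> S" "x \<in> T"
    then obtain i j where "x \<in> F i \<inter> G j" using F G by auto
    then show "x \<in> (\<Union>n. F (fst (prod_decode n)) \<inter> G (snd (prod_decode n)))"
      by (intro UN_I[of "prod_encode (i, j)"]) auto
  qed (use F G in auto)
  then show ?thesis
    unfolding sigma_compact_def using F(1) G(1)
    by (intro exI[of _ "\<lambda>n. F (fst (prod_decode n)) \<inter> G (snd (prod_decode n))"]) (auto intro: compact_Int)
qed

lemma compact_imp_sigma_compact: "compact S \<Longrightarrow> sigma_compact S"
  unfolding sigma_compact_def by (intro exI[of _ "\<lambda>_. S"]) auto

lemma closed_imp_sigma_compact:
  fixes S :: "'a::euclidean_space set"
  assumes "closed S" shows "sigma_compact S"
  unfolding sigma_compact_def using assms real_arch_simple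
  by (intro exI[of _ "\<lambda>n. S \<inter> cball 0 (real n)"]) (auto intro: closed_Int_compact)

lemma open_imp_sigma_compact:
  fixes S :: "'a::euclidean_space set"
  assumes "open S" shows "sigma_compact S"
  using open_Union_compact_subsets[OF assms] unfolding sigma_compact_def by metis

section \<open>Norms of projected and stretched vectors\<close>

definition projection :: "'a::real_inner \<Rightarrow> 'a \<Rightarrow> 'a" where
  "projection v x = x - (x \<bullet> v) *\<^sub>R v"

lemma continuous_projection: "continuous_on S (projection v)"
  unfolding projection_def[abs_def] by (intro continuous_intros)

lemma linear_projection: "linear (projection v)"
  by unfold_locales (auto simp: projection_def inner_add_left algebra_simps)

lemma norm_stretch_power2:
  assumes "norm b = 1"
  shows "(norm (stretch b c z))\<^sup>2 = (norm z)\<^sup>2 + (c\<^sup>2 - 1) * (z \<bullet> b)\<^sup>2"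
proof -
  have "b \<bullet> b = 1" using assms by (simp add: norm_eq_1)
  then show ?thesis
    unfolding power2_norm_eq_inner stretch_def
    by (simp add: inner_add_left inner_add_right inner_commute[of b z] power2_eq_square algebra_simps)
qed

lemma norm_stretch_mono:
  assumes "norm b = 1" "0 \<le> c" "c \<le> d"
  shows "norm (stretch b c z) \<le> norm (stretch b d z)"
proof (rule power2_le_imp_le)
  have "c\<^sup>2 \<le> d\<^sup>2" using assms by (intro power_mono) auto
  then show "(norm (stretch b c z))\<^sup>2 \<le> (norm (stretch b d z))\<^sup>2"
    unfolding norm_stretch_power2[OF assms(1)] by (intro add_left_mono mult_right_mono) auto
qed simp

text \<open>The singular values of the stretch by \<open>c \<ge> 0\<close> are among 1 and
  \<open>c\<close>, so every nonnegative \<open>e\<close> below both is a lower bound for its action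
  on norms.\<close>

lemma norm_le_stretch:
  assumes "norm b = 1" "0 \<le> e" "e \<le> c" "e \<le> 1"
  shows "e * norm z \<le> norm (stretch b c z)"
proof (rule power2_le_imp_le)
  have "e\<^sup>2 \<le> 1" "e\<^sup>2 \<le> c\<^sup>2" using assms power_mono[of e 1 2] power_mono[of e c 2] by auto
  have "(z \<bullet> b)\<^sup>2 \<le> (norm z)\<^sup>2"
    using Cauchy_Schwarz_ineq2[of z b] assms(1) abs_le_square_iff[of "z \<bullet> b" "norm z"] by simp
  then have "0 \<le> (1 - e\<^sup>2) * ((norm z)\<^sup>2 - (z \<bullet> b)\<^sup>2)"
    using \<open>e\<^sup>2 \<le> 1\<close> by (intro mult_nonneg_nonneg) auto
  moreover have "0 \<le> (c\<^sup>2 - e\<^sup>2) * (z \<bullet> b)\<^sup>2"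
    using \<open>e\<^sup>2 \<le> c\<^sup>2\<close> by (intro mult_nonneg_nonneg) auto
  ultimately show "(e * norm z)\<^sup>2 \<le> (norm (stretch b c z))\<^sup>2"
    unfolding norm_stretch_power2[OF assms(1)] power_mult_distrib by (simp add: algebra_simps)
qed simp

text \<open>For a unit vector \<open>w\<close> and \<open>0 \<le> \<epsilon> < 1\<close> these are
  the Lipschitz graphs over subsets of the hyperplane orthogonal to \<open>w\<close>, with slope
  bounded in terms of \<open>\<epsilon>\<close>.\<close>

definition flat_set :: "real \<Rightarrow> 'a::real_inner \<Rightarrow> 'a set \<Rightarrow> bool" where
  "flat_set \<epsilon> w B \<longleftrightarrow> (\<forall>x\<in>B. \<forall>y\<in>B. \<bar>(x - y) \<bullet> w\<bar> \<le> \<epsilon> * norm (x - y))"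

text \<open>
  The map \<open>y\<close> of the proof is the orthogonal projection onto \<open>w\<^sup>\<bottom>\<close> followed by the rotation taking
  \<open>w, a\<close> to \<open>v, b\<close>; then \<open>\<pi> x\<close> and \<open>stretch b c (y x)\<close> differ by at most \<open>\<bar>x \<bullet> w\<bar>\<close>. For the upper bound
  the factor \<open>c\<close> is raised to \<open>c + \<eta>\<close> so that the stretch stays invertible when \<open>c\<close> is small or zero.
\<close>

lemma flat_set_projection_aux:
  fixes B :: "'a::euclidean_space set"
  assumes v: "norm v = 1" and b: "norm b = 1" "b \<bullet> v = 0" and w: "w = c *\<^sub>R v + s *\<^sub>R b"
    and cs: "0 \<le> c" "c\<^sup>2 + s\<^sup>2 = 1" and \<eta>: "0 < \<eta>" "\<eta> \<le> 1/2"
    and B: "sigma_compact B" "flat_set (\<eta>\<^sup>2 / 2) w B" and m: "m = DIM('a) - 1"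
  shows "hausdorff_outer m (projection v ` B)
          \<le> ennreal ((1 + 2 * \<eta>) ^ m) * (ennreal (c + \<eta>) * hausdorff_outer m B)" (is ?upper)
    and "\<eta> \<le> c \<Longrightarrow> ennreal c * hausdorff_outer m B
          \<le> ennreal ((1 + 2 * \<eta>) ^ m) * (ennreal ((1 + 2 * \<eta>) ^ m) * hausdorff_outer m (projection v ` B))"
      (is "_ \<Longrightarrow> ?lower")
proof -
  \<comment> \<open>Completes \<open>w\<close> to an orthonormal basis of the plane of
    \<open>v\<close> and \<open>b\<close>. Outside this plane the rotation is the identity, so
    \<open>y\<close> only drops the \<open>v\<close>-component and replaces the
    \<open>b\<close>-coordinate by the \<open>a\<close>-coordinate.\<close>
  define a where "a = c *\<^sub>R b - s *\<^sub>R v"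
  define y where "y x = projection v x + (x \<bullet> a - x \<bullet> b) *\<^sub>R b" for x
  define V where "V = {u. v \<bullet> u = 0}"
  have ips: "b \<bullet> b = 1" "v \<bullet> v = 1" "v \<bullet> b = 0"
    using v b by (simp_all add: norm_eq_1 inner_commute)
  have V: "subspace V" "dim V = m" "b \<in> V"
    using v m b(2) subspace_hyperplane[of v] dim_hyperplane[of v] norm_zero[where 'a='a]
    unfolding V_def by (fastforce simp: inner_commute)+
  have yV: "y x \<in> V" for x
    by (simp add: V_def y_def projection_def inner_add_right inner_diff_right ips inner_commute[of v x])
  have yb: "y x \<bullet> b = x \<bullet> a" for x
    by (simp add: y_def projection_def inner_add_left inner_diff_left ips)
  have xb: "x \<bullet> b = c * (x \<bullet> a) + s * (x \<bullet> w)" for x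
  proof -
    have "c * (x \<bullet> a) + s * (x \<bullet> w) = (c\<^sup>2 + s\<^sup>2) * (x \<bullet> b)"
      unfolding a_def w by (simp add: inner_diff_right inner_add_right power2_eq_square algebra_simps)
    then show ?thesis using cs(2) by simp
  qed
  have proj: "projection v x = stretch b c (y x) + (s * (x \<bullet> w)) *\<^sub>R b" for x
    unfolding stretch_def yb xb[of x] unfolding y_def xb[of x] by (simp add: algebra_simps)
  have "\<bar>s\<bar> \<le> 1" using cs by (metis abs_square_le_1 le_add_same_cancel2 zero_le_power2)
  have proj_diff: "norm (projection v x - stretch b c (y x)) \<le> \<bar>x \<bullet> w\<bar>" for x
    unfolding proj[of x] using \<open>\<bar>s\<bar> \<le> 1\<close> b(1) by (simp add: abs_mult mult_left_le_one_le)
  have ynorm: "(norm x)\<^sup>2 = (norm (y x))\<^sup>2 + (x \<bullet> w)\<^sup>2" for x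
  proof -
    have "(x \<bullet> a)\<^sup>2 + (x \<bullet> w)\<^sup>2 = (c\<^sup>2 + s\<^sup>2) * ((x \<bullet> b)\<^sup>2 + (x \<bullet> v)\<^sup>2)"
      unfolding a_def w by (simp add: inner_diff_right inner_add_right power2_eq_square algebra_simps)
    then have 1: "(x \<bullet> a)\<^sup>2 + (x \<bullet> w)\<^sup>2 = (x \<bullet> b)\<^sup>2 + (x \<bullet> v)\<^sup>2" using cs(2) by simp
    have "(norm (y x))\<^sup>2 = (norm x)\<^sup>2 - (x \<bullet> v)\<^sup>2 + (x \<bullet> a)\<^sup>2 - (x \<bullet> b)\<^sup>2"
      unfolding power2_norm_eq_inner y_def projection_def
      by (simp add: inner_diff_right inner_add_right inner_diff_left inner_add_left ips b(2)
          inner_commute[of v x] inner_commute[of b x] power2_eq_square algebra_simps)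
    then show ?thesis using 1 by simp
  qed
  have y_le: "norm (y x) \<le> norm x" for x
    by (rule power2_le_imp_le) (use ynorm[of x] in auto)
  have le_y: "norm x \<le> norm (y x) + \<bar>x \<bullet> w\<bar>" for x
    by (rule power2_le_imp_le) (use ynorm[of x] in \<open>auto simp: power2_sum\<close>)
  have lin_y: "linear y"
    by unfold_locales (auto simp: y_def projection_def inner_add_left algebra_simps)
  have lin: "linear (projection v)" "linear (\<lambda>x. stretch b d (y x))" for d
    using linear_projection linear_compose[OF lin_y linear_stretch[of b d]] by (auto simp: o_def)
  have dst: "dist (projection v p) (projection v q) = norm (projection v (p - q))"
      "dist (y p) (y q) = norm (y (p - q))"
      "dist (stretch b d (y p)) (stretch b d (y q)) = norm (stretch b d (y (p - q)))" for p q d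
    using linear_diff[OF lin(1)] linear_diff[OF lin_y] linear_diff[OF lin(2)]
    by (simp_all add: dist_norm)
  \<comment> \<open>One factor \<open>\<eta>\<close> is spent in \<open>key\<close>, where
    \<open>norm (y x)\<close> is at most the norm of the stretched vector divided by
    \<open>\<eta>\<close>; the other remains as the relative error. The half in the hypothesis pays
    for passing from \<open>norm x\<close> to \<open>norm (y x)\<close>.\<close>
  have small: "\<bar>x \<bullet> w\<bar> \<le> \<eta>\<^sup>2 * norm (y x)" "norm x \<le> (1 + 2 * \<eta>) * norm (y x)"
    if "\<bar>x \<bullet> w\<bar> \<le> \<eta>\<^sup>2 / 2 * norm x" for x
  proof -
    have "\<eta>\<^sup>2 \<le> \<eta>" using \<eta> by (simp add: power2_eq_square mult_left_le)
    then have "\<eta>\<^sup>2 / 2 * norm x \<le> 1 / 2 * norm x" using \<eta> by (intro mult_right_mono) auto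
    then have "norm x \<le> 2 * norm (y x)" using le_y[of x] that by linarith
    then have "\<eta>\<^sup>2 / 2 * norm x \<le> \<eta>\<^sup>2 / 2 * (2 * norm (y x))" by (intro mult_left_mono) auto
    then show 1: "\<bar>x \<bullet> w\<bar> \<le> \<eta>\<^sup>2 * norm (y x)" using that by simp
    have "\<eta>\<^sup>2 * norm (y x) \<le> 2 * \<eta> * norm (y x)"
      using \<open>\<eta>\<^sup>2 \<le> \<eta>\<close> \<eta> by (intro mult_right_mono) auto
    then show "norm x \<le> (1 + 2 * \<eta>) * norm (y x)" using le_y[of x] 1 by (simp add: algebra_simps)
  qed
  have fl: "\<bar>(p - q) \<bullet> w\<bar> \<le> \<eta>\<^sup>2 / 2 * norm (p - q)" if "p \<in> B" "q \<in> B" for p q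
    using B(2) that by (auto simp: flat_set_def)
  have stretch_y: "hausdorff_outer m ((\<lambda>x. stretch b d (y x)) ` B) = ennreal d * hausdorff_outer m (y ` B)"
    if "0 < d" for d
  proof -
    have "continuous_on UNIV y" using lin_y by (simp add: linear_continuous_on linear_linear)
    then have "y ` B \<in> sets borel" using B(1) by (intro sigma_compact_borel sigma_compact_image)
    moreover have "(\<lambda>x. stretch b d (y x)) ` B = stretch b d ` y ` B" by (simp add: image_image)
    moreover have "y ` B \<subseteq> V" using yV by blast
    ultimately show ?thesis by (metis hausdorff_outer_stretch[OF V b(1) that])
  qed
  have y_B: "hausdorff_outer m (y ` B) \<le> hausdorff_outer m B"
    using hausdorff_outer_lipschitz_image[of 1 B y m] y_le
    by (simp add: dst) (simp add: dist_norm)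
  have pos: "0 < 1 + 2 * \<eta>" using \<eta> by simp
  show ?upper
  proof -
    have key: "norm (projection v x) \<le> (1 + 2 * \<eta>) * norm (stretch b (c + \<eta>) (y x))"
      if "\<bar>x \<bullet> w\<bar> \<le> \<eta>\<^sup>2 / 2 * norm x" for x
    proof -
      have "\<eta> * norm (y x) \<le> norm (stretch b (c + \<eta>) (y x))"
        using \<eta> cs(1) b(1) by (intro norm_le_stretch) auto
      then have "\<eta> * (\<eta> * norm (y x)) \<le> \<eta> * norm (stretch b (c + \<eta>) (y x))"
        using \<eta> by (intro mult_left_mono) auto
      then have "\<bar>x \<bullet> w\<bar> \<le> \<eta> * norm (stretch b (c + \<eta>) (y x))"
        using small(1)[OF that] by (simp add: power2_eq_square mult.assoc)
      moreover have "norm (stretch b c (y x)) \<le> norm (stretch b (c + \<eta>) (y x))"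
        using \<eta> cs(1) b(1) by (intro norm_stretch_mono) auto
      moreover have "norm (projection v x) \<le> norm (stretch b c (y x)) + \<bar>x \<bullet> w\<bar>"
        using proj_diff[of x] norm_triangle_ineq2[of "projection v x" "stretch b c (y x)"] by linarith
      moreover have "0 \<le> \<eta> * norm (stretch b (c + \<eta>) (y x))" using \<eta> by simp
      ultimately show ?thesis by (simp add: distrib_right)
    qed
    have "hausdorff_outer m (projection v ` B)
        \<le> ennreal ((1 + 2 * \<eta>) ^ m) * hausdorff_outer m ((\<lambda>x. stretch b (c + \<eta>) (y x)) ` B)"
      using key[OF fl] pos by (intro hausdorff_outer_image_le_image) (simp_all add: dst)
    also have "hausdorff_outer m ((\<lambda>x. stretch b (c + \<eta>) (y x)) ` B) \<le> ennreal (c + \<eta>) * hausdorff_outer m B"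
      using y_B stretch_y[of "c + \<eta>"] \<eta> cs(1) by (simp add: mult_left_mono)
    finally show ?thesis by (simp add: mult_left_mono)
  qed
  show ?lower if "\<eta> \<le> c"
  proof -
    have "c\<^sup>2 \<le> 1" using cs(2) by (metis le_add_same_cancel1 zero_le_power2)
    then have "c \<le> 1" using cs(1) by (simp add: abs_square_le_1)
    have key: "norm (stretch b c (y x)) \<le> (1 + 2 * \<eta>) * norm (projection v x)"
      if "\<bar>x \<bullet> w\<bar> \<le> \<eta>\<^sup>2 / 2 * norm x" for x
    proof -
      define z where "z = norm (stretch b c (y x))"
      have "\<eta> * norm (y x) \<le> z"
        unfolding z_def using \<eta> \<open>\<eta> \<le> c\<close> b(1) by (intro norm_le_stretch) auto
      then have "\<eta> * (\<eta> * norm (y x)) \<le> \<eta> * z"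
        using \<eta> by (intro mult_left_mono) auto
      then have "\<bar>x \<bullet> w\<bar> \<le> \<eta> * z"
        using small(1)[OF that] by (simp add: power2_eq_square mult.assoc)
      moreover have "z \<le> norm (projection v x) + \<bar>x \<bullet> w\<bar>"
        unfolding z_def using proj_diff[of x] norm_triangle_ineq3[of "projection v x" "stretch b c (y x)"] by linarith
      ultimately have "(1 - \<eta>) * z \<le> norm (projection v x)" by (simp add: algebra_simps)
      then have "(1 + 2 * \<eta>) * ((1 - \<eta>) * z) \<le> (1 + 2 * \<eta>) * norm (projection v x)"
        using pos by (intro mult_left_mono) auto
      \<comment> \<open>The constant \<open>1 + 2 * \<eta>\<close> comes from inverting
        \<open>1 - \<eta>\<close>: their product is at least 1 because
        \<open>\<eta> \<le> 1/2\<close>.\<close>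
      moreover have "1 * z \<le> ((1 + 2 * \<eta>) * (1 - \<eta>)) * z"
      proof (rule mult_right_mono)
        have "0 \<le> \<eta> * (1 - 2 * \<eta>)" using \<eta> by (intro mult_nonneg_nonneg) auto
        then show "1 \<le> (1 + 2 * \<eta>) * (1 - \<eta>)" by (simp add: algebra_simps)
      qed (simp add: z_def)
      ultimately show ?thesis by (simp add: mult.assoc z_def)
    qed
    have "hausdorff_outer m ((\<lambda>x. x) ` B) \<le> ennreal ((1 + 2 * \<eta>) ^ m) * hausdorff_outer m (y ` B)"
      using small(2)[OF fl] pos
      by (intro hausdorff_outer_image_le_image) (simp_all add: dst, simp add: dist_norm)
    then have "ennreal c * hausdorff_outer m B
        \<le> ennreal c * (ennreal ((1 + 2 * \<eta>) ^ m) * hausdorff_outer m (y ` B))"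
      by (intro mult_left_mono) auto
    also have "\<dots> = ennreal ((1 + 2 * \<eta>) ^ m) * hausdorff_outer m ((\<lambda>x. stretch b c (y x)) ` B)"
      using stretch_y[of c] \<eta> that by (simp add: ac_simps)
    also have "\<dots> \<le> ennreal ((1 + 2 * \<eta>) ^ m) * (ennreal ((1 + 2 * \<eta>) ^ m) * hausdorff_outer m (projection v ` B))"
      using key[OF fl] pos
      by (intro mult_left_mono hausdorff_outer_image_le_image) (simp_all add: dst)
    finally show ?thesis .
  qed
qed

text \<open>Supplies the frame of the auxiliary lemma: the sign of \<open>w\<close> is chosen so
  that \<open>c \<ge> 0\<close>, and \<open>b\<close> is the normalised part of \<open>w\<close>
  orthogonal to \<open>v\<close>, or any unit vector orthogonal to \<open>v\<close> if that part is
  0. In dimension 1 there is no such \<open>b\<close>, but there a flat set has at most one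
  point.\<close>

lemma flat_set_projection:
  fixes B :: "'a::euclidean_space set"
  assumes v: "norm v = 1" and w: "norm w = 1" and \<eta>: "0 < \<eta>" "\<eta> \<le> 1/2"
    and B: "sigma_compact B" "flat_set (\<eta>\<^sup>2 / 2) w B" and m: "m = DIM('a) - 1"
  shows "hausdorff_outer m (projection v ` B)
          \<le> ennreal ((1 + 2 * \<eta>) ^ m) * (ennreal (\<bar>v \<bullet> w\<bar> + \<eta>) * hausdorff_outer m B) \<and>
    (\<eta> \<le> \<bar>v \<bullet> w\<bar> \<longrightarrow> ennreal \<bar>v \<bullet> w\<bar> * hausdorff_outer m B
          \<le> ennreal ((1 + 2 * \<eta>) ^ m) * (ennreal ((1 + 2 * \<eta>) ^ m) * hausdorff_outer m (projection v ` B)))"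
proof (cases "2 \<le> DIM('a)")
  case True
  define w' where "w' = (if 0 \<le> v \<bullet> w then w else - w)"
  define c where "c = v \<bullet> w'"
  define s where "s = norm (w' - c *\<^sub>R v)"
  have w': "norm w' = 1" "c = \<bar>v \<bullet> w\<bar>" "flat_set (\<eta>\<^sup>2 / 2) w' B"
    using w B(2) by (auto simp: w'_def c_def flat_set_def)
  have ips: "v \<bullet> v = 1" "w' \<bullet> w' = 1" "w' \<bullet> v = c" "v \<bullet> w' = c"
    using v w' by (simp_all add: norm_eq_1 c_def inner_commute)
  have s2: "s\<^sup>2 = 1 - c\<^sup>2"
    unfolding s_def power2_norm_eq_inner
    by (simp add: inner_diff_left inner_diff_right ips power2_eq_square)
  obtain b where b: "norm b = 1" "b \<bullet> v = 0" "w' = c *\<^sub>R v + s *\<^sub>R b"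
  proof (cases "s = 0")
    case True
    obtain z where "z \<noteq> 0" "orthogonal v z"
      using orthogonal_to_vector_exists[OF \<open>2 \<le> DIM('a)\<close>] by blast
    then show thesis
      using that[of "z /\<^sub>R norm z"] True by (simp add: s_def orthogonal_def inner_commute)
  next
    case False
    then show thesis
      using that[of "(w' - c *\<^sub>R v) /\<^sub>R s"] by (simp add: inner_diff_left ips) (simp add: s_def)
  qed
  show ?thesis
    using flat_set_projection_aux[OF v b _ _ \<eta> B(1) w'(3) m] s2 w'(2) by auto
next
  case False
  then have D: "DIM('a) = 1" using DIM_positive[where 'a='a] by linarith
  then have "m = 0" using m by simp
  have one: "norm x = \<bar>x \<bullet> w\<bar>" for x :: 'a
  proof -
    have "w \<bullet> w = 1" using w by (simp add: norm_eq_1)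
    have "dim {u. w \<bullet> u = 0} = 0" using w D by (subst dim_hyperplane) auto
    then have "{u. w \<bullet> u = 0} \<subseteq> {0}" by simp
    moreover have "x - (x \<bullet> w) *\<^sub>R w \<in> {u. w \<bullet> u = 0}"
      by (simp add: inner_diff_right \<open>w \<bullet> w = 1\<close> inner_commute)
    ultimately have "x = (x \<bullet> w) *\<^sub>R w" by auto
    then have "norm x = norm ((x \<bullet> w) *\<^sub>R w)" by simp
    then show ?thesis using w by simp
  qed
  have vw: "\<bar>v \<bullet> w\<bar> = 1" using one[of v] v by simp
  have eq: "x = y" if "x \<in> B" "y \<in> B" for x y
  proof -
    have "norm (x - y) \<le> \<eta>\<^sup>2 / 2 * norm (x - y)"
      using B(2) that one[of "x - y"] unfolding flat_set_def by metis
    moreover have "\<eta>\<^sup>2 \<le> 1" using \<eta> by (simp add: abs_square_le_1)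
    then have "\<eta>\<^sup>2 / 2 * norm (x - y) \<le> 1 / 2 * norm (x - y)" by (intro mult_right_mono) auto
    ultimately have "norm (x - y) \<le> 0" by linarith
    then show ?thesis by simp
  qed
  have "hausdorff_outer m (projection v ` B) = hausdorff_outer m B"
  proof (rule hausdorff_outer_isometry)
    fix x y assume "x \<in> B" "y \<in> B"
    then have "x = y" by (rule eq)
    then show "dist (projection v x) (projection v y) = dist x y" by simp
  qed
  then show ?thesis
    using \<eta> mult_right_mono[of 1 "ennreal (1 + \<eta>)" "hausdorff_outer m B"]
    by (simp add: vw \<open>m = 0\<close>)
qed

section \<open>Counting intersections with parallel lines\<close>

lemma emeasure_count_space_image_le:
  "emeasure (count_space UNIV) (f ` T) \<le> emeasure (count_space UNIV) T"
proof (cases "finite T")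
  case True
  then show ?thesis by (simp add: emeasure_count_space card_image_le of_nat_mono)
qed (simp add: emeasure_count_space)

lemma emeasure_count_space_image_inj:
  "inj_on f T \<Longrightarrow> emeasure (count_space UNIV) (f ` T) = emeasure (count_space UNIV) T"
  by (simp add: emeasure_count_space card_image finite_image_iff)

text \<open>
  The dyadic interval of length \<open>2\<^sup>-\<^sup>k\<close> containing \<open>t\<close>, encoded as a natural number.
\<close>

definition dyadic_cell :: "nat \<Rightarrow> real \<Rightarrow> nat" where
  "dyadic_cell k t = int_encode \<lfloor>2 ^ k * t\<rfloor>"

text \<open>Each cell has a unique parent, with half the index rounded down. Hence refining cannot
  decrease the number of occupied cells.\<close>

lemma dyadic_cell_Suc: "dyadic_cell k t = int_encode (int_decode (dyadic_cell (Suc k) t) div 2)"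
proof -
  have "\<lfloor>2 ^ Suc k * t / real_of_int 2\<rfloor> = \<lfloor>2 ^ Suc k * t\<rfloor> div 2"
    by (rule floor_divide_real_eq_div) simp
  then show ?thesis by (simp add: dyadic_cell_def)
qed

lemma dyadic_cell_eventually_inj:
  assumes "finite F" shows "\<exists>k. inj_on (dyadic_cell k) F"
proof -
  have sep: "\<forall>\<^sub>F k in sequentially. dyadic_cell k s \<noteq> dyadic_cell k t" if "s \<noteq> t" for s t
  proof -
    obtain K where K: "1 / \<bar>s - t\<bar> < 2 ^ K"
      using real_arch_pow[of 2 "1 / \<bar>s - t\<bar>"] by auto
    have "dyadic_cell k s \<noteq> dyadic_cell k t" if "K \<le> k" for k
    proof
      assume "dyadic_cell k s = dyadic_cell k t"
      then have "\<lfloor>2 ^ k * s\<rfloor> = \<lfloor>2 ^ k * t\<rfloor>" by (metis dyadic_cell_def int_encode_inverse)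
      then have "\<bar>2 ^ k * s - 2 ^ k * t\<bar> < 1" by linarith
      then have "2 ^ k * \<bar>s - t\<bar> < 1" by (simp add: abs_mult flip: right_diff_distrib)
      moreover have "(2::real) ^ K \<le> 2 ^ k" using that by (intro power_increasing) auto
      ultimately have "2 ^ K * \<bar>s - t\<bar> < 1" by (meson abs_ge_zero le_less_trans mult_right_mono)
      with K \<open>s \<noteq> t\<close> show False by (simp add: divide_less_eq)
    qed
    then show ?thesis by (auto simp: eventually_sequentially)
  qed
  have "\<forall>\<^sub>F k in sequentially. \<forall>s\<in>F. \<forall>t\<in>F. s \<noteq> t \<longrightarrow> dyadic_cell k s \<noteq> dyadic_cell k t"
    using assms sep by (intro eventually_ball_finite ballI) (auto intro: always_eventually)
  then show ?thesis
    by (auto simp: eventually_sequentially inj_on_def)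
qed

lemma incseq_emeasure_dyadic_image:
  "incseq (\<lambda>k. emeasure (count_space UNIV) (dyadic_cell k ` T))"
proof (rule incseq_SucI)
  fix k
  have "dyadic_cell k ` T = (\<lambda>n. int_encode (int_decode n div 2)) ` dyadic_cell (Suc k) ` T"
    unfolding image_image by (rule image_cong[OF refl dyadic_cell_Suc])
  then show "emeasure (count_space UNIV) (dyadic_cell k ` T) \<le> emeasure (count_space UNIV) (dyadic_cell (Suc k) ` T)"
    by (simp only: emeasure_count_space_image_le)
qed

text \<open>Occupied cells never outnumber the points, and fine cells separate any finite set of
  points. Unlike the cardinality, the count of occupied cells is built from countably many
  membership tests, so it stays measurable when \<open>T\<close> varies with a line.\<close>

lemma emeasure_count_space_eq_SUP_dyadic:
  "emeasure (count_space UNIV) T = (SUP k. emeasure (count_space UNIV) (dyadic_cell k ` T))" (is "_ = ?R")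
proof (rule antisym)
  have card_le: "of_nat (card F) \<le> ?R" if F: "finite F" "F \<subseteq> T" for F
  proof -
    obtain k where k: "inj_on (dyadic_cell k) F" using dyadic_cell_eventually_inj[OF F(1)] by blast
    have "of_nat (card F) = emeasure (count_space UNIV) (dyadic_cell k ` F)"
      using F(1) k by (simp add: emeasure_count_space card_image)
    also have "\<dots> \<le> emeasure (count_space UNIV) (dyadic_cell k ` T)"
      using F(2) by (intro emeasure_mono) auto
    also have "\<dots> \<le> ?R" by (rule SUP_upper) simp
    finally show ?thesis .
  qed
  show "emeasure (count_space UNIV) T \<le> ?R"
  proof (cases "finite T")
    case True
    then show ?thesis using card_le[of T] by (simp add: emeasure_count_space)
  next
    case False
    have "of_nat n \<le> ?R" for n
      using infinite_arbitrarily_large[OF False, of n] card_le by metis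
    then have "?R = top"
      by (metis ennreal_Ex_less_of_nat leD less_top)
    then show ?thesis by (metis top_greatest)
  qed
qed (rule SUP_least, rule emeasure_count_space_image_le)

section \<open>Crossing numbers as limits of sums of indicators\<close>

definition line :: "'a::real_vector \<Rightarrow> 'a \<Rightarrow> 'a set" where
  "line v u = {u + t *\<^sub>R v | t. True}"

definition crossings :: "'a::real_vector \<Rightarrow> 'a set \<Rightarrow> 'a \<Rightarrow> ennreal" where
  "crossings v B u = emeasure (count_space UNIV) (line v u \<inter> B)"

definition slab :: "'a::real_inner \<Rightarrow> nat \<Rightarrow> nat \<Rightarrow> 'a set" where
  "slab v k n = {x. dyadic_cell k (x \<bullet> v) = n}"

lemma sigma_compact_slab: "sigma_compact (slab (v :: 'a::euclidean_space) k n)"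
proof -
  let ?j = "real_of_int (int_decode n)"
  have "\<lfloor>2 ^ k * t\<rfloor> = int_decode n \<longleftrightarrow> ?j \<le> 2 ^ k * t \<and> 2 ^ k * t < ?j + 1" for t
    by (simp add: floor_eq_iff)
  moreover have "dyadic_cell k t = n \<longleftrightarrow> \<lfloor>2 ^ k * t\<rfloor> = int_decode n" for t
    by (metis dyadic_cell_def int_decode_inverse int_encode_inverse)
  ultimately have "slab v k n = {x. ?j \<le> 2 ^ k * (x \<bullet> v)} \<inter> {x. 2 ^ k * (x \<bullet> v) < ?j + 1}"
    by (auto simp: slab_def)
  moreover have "closed {x. ?j \<le> 2 ^ k * (x \<bullet> v)}" by (intro closed_Collect_le continuous_intros)
  moreover have "open {x. 2 ^ k * (x \<bullet> v) < ?j + 1}" by (intro open_Collect_less continuous_intros)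
  ultimately show ?thesis
    by (simp add: sigma_compact_Int closed_imp_sigma_compact open_imp_sigma_compact)
qed

text \<open>With the line parametrised by its \<open>v\<close>-coordinate, \<open>u\<close> lies in
  the projection of the \<open>n\<close>-th layer of \<open>B\<close> exactly if the cell
  \<open>n\<close> is occupied on the line over \<open>u\<close>; the sum counts the occupied
  cells.\<close>

lemma crossings_eq_SUP:
  fixes v :: "'a::euclidean_space"
  assumes v: "norm v = 1" and u: "v \<bullet> u = 0"
  shows "crossings v B u = (SUP k. \<Sum>n. indicator (projection v ` (B \<inter> slab v k n)) u)"
    and "incseq (\<lambda>k. \<Sum>n. indicator (projection v ` (B \<inter> slab v k n)) u :: ennreal)"
proof -
  define T where "T = {t. u + t *\<^sub>R v \<in> B}"
  have vv: "v \<bullet> v = 1" using v by (simp add: norm_eq_1)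
  have "line v u \<inter> B = (\<lambda>t. u + t *\<^sub>R v) ` T" by (auto simp: line_def T_def)
  moreover have "inj_on (\<lambda>t. u + t *\<^sub>R v) T" using v by (auto simp: inj_on_def)
  ultimately have T: "crossings v B u = emeasure (count_space UNIV) T"
    by (simp only: crossings_def emeasure_count_space_image_inj)
  have mem: "u \<in> projection v ` (B \<inter> slab v k n) \<longleftrightarrow> n \<in> dyadic_cell k ` T" for k n
  proof
    assume "u \<in> projection v ` (B \<inter> slab v k n)"
    then obtain x where "x \<in> B" "dyadic_cell k (x \<bullet> v) = n" "u = x - (x \<bullet> v) *\<^sub>R v"
      by (auto simp: projection_def slab_def)
    then show "n \<in> dyadic_cell k ` T" by (auto simp: T_def intro!: image_eqI[of _ _ "x \<bullet> v"])
  next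
    assume "n \<in> dyadic_cell k ` T"
    then obtain t where t: "u + t *\<^sub>R v \<in> B" "n = dyadic_cell k t" by (auto simp: T_def)
    have "(u + t *\<^sub>R v) \<bullet> v = t" using u by (simp add: inner_add_left vv inner_commute[of u v])
    then show "u \<in> projection v ` (B \<inter> slab v k n)"
      using t by (auto simp: projection_def slab_def intro!: image_eqI[of _ _ "u + t *\<^sub>R v"])
  qed
  have "emeasure (count_space UNIV) S = (\<Sum>n. indicator S n)" for S :: "nat set"
    by (simp flip: nn_integral_count_space_nat)
  then have sum: "(\<Sum>n. indicator (projection v ` (B \<inter> slab v k n)) u)
      = emeasure (count_space UNIV) (dyadic_cell k ` T)" for k
    by (simp add: indicator_def mem)
  show "crossings v B u = (SUP k. \<Sum>n. indicator (projection v ` (B \<inter> slab v k n)) u)"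
    unfolding sum T by (rule emeasure_count_space_eq_SUP_dyadic)
  show "incseq (\<lambda>k. \<Sum>n. indicator (projection v ` (B \<inter> slab v k n)) u :: ennreal)"
    unfolding sum by (rule incseq_emeasure_dyadic_image)
qed

definition perp :: "'a::real_inner \<Rightarrow> 'a set" where
  "perp v = {u. v \<bullet> u = 0}"

lemma projection_in_perp: "norm v = 1 \<Longrightarrow> projection v x \<in> perp v"
  by (simp add: projection_def perp_def inner_diff_right norm_eq_1 inner_commute)

lemma crossings_indicator:
  fixes v :: "'a::euclidean_space"
  assumes v: "norm v = 1"
  shows "crossings v B u * indicator (perp v) u = (SUP k. \<Sum>n. indicator (projection v ` (B \<inter> slab v k n)) u)"
    and "incseq (\<lambda>k. \<Sum>n. indicator (projection v ` (B \<inter> slab v k n)) u :: ennreal)"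
proof -
  have "indicator (projection v ` (B \<inter> slab v k n)) u = (0 :: ennreal)" if "u \<notin> perp v" for k n
    using that projection_in_perp[OF v] by (auto simp: indicator_def)
  then show "crossings v B u * indicator (perp v) u = (SUP k. \<Sum>n. indicator (projection v ` (B \<inter> slab v k n)) u)"
      "incseq (\<lambda>k. \<Sum>n. indicator (projection v ` (B \<inter> slab v k n)) u :: ennreal)"
    using crossings_eq_SUP[OF v, of u B] by (cases "u \<in> perp v"; simp add: perp_def)+
qed

lemma borel_measurable_crossings:
  fixes v :: "'a::euclidean_space"
  assumes v: "norm v = 1" and B: "sigma_compact B"
  shows "(\<lambda>u. crossings v B u * indicator (perp v) u) \<in> borel_measurable borel"
proof -
  have [measurable]: "projection v ` (B \<inter> slab v k n) \<in> sets borel" for k n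
    by (intro sigma_compact_borel sigma_compact_image sigma_compact_Int sigma_compact_slab B continuous_projection)
  show ?thesis unfolding crossings_indicator(1)[OF v] by measurable
qed

text \<open>Monotone convergence in the slab width leaves only areas of projections, to which the
  estimates for flat sets apply.\<close>

lemma nn_integral_crossings:
  fixes v :: "'a::euclidean_space"
  assumes v: "norm v = 1" and B: "sigma_compact B"
  shows "(\<integral>\<^sup>+u\<in>perp v. crossings v B u \<partial>hausdorff_measure m)
    = (SUP k. \<Sum>n. hausdorff_outer m (projection v ` (B \<inter> slab v k n)))"
proof -
  have meas [measurable]: "projection v ` (B \<inter> slab v k n) \<in> sets borel" for k n
    by (intro sigma_compact_borel sigma_compact_image sigma_compact_Int sigma_compact_slab B continuous_projection)
  show ?thesis
    unfolding crossings_indicator(1)[OF v] using crossings_indicator(2)[OF v]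
    by (subst nn_integral_monotone_convergence_SUP)
       (auto simp: nn_integral_suminf emeasure_hausdorff_measure incseq_def le_fun_def)
qed

lemma suminf_hausdorff_slabs:
  assumes [measurable]: "B \<in> sets borel"
  shows "(\<Sum>n. hausdorff_outer m (B \<inter> slab v k n)) = hausdorff_outer m (B :: 'a::euclidean_space set)"
proof -
  have [measurable]: "slab v k n \<in> sets borel" for n
    by (intro sigma_compact_borel sigma_compact_slab)
  have "(\<Sum>n. emeasure (hausdorff_measure m) (B \<inter> slab v k n)) = emeasure (hausdorff_measure m) (\<Union>n. B \<inter> slab v k n)"
  proof (rule suminf_emeasure)
    show "range (\<lambda>n. B \<inter> slab v k n) \<subseteq> sets (hausdorff_measure m)" by auto
  qed (auto simp: disjoint_family_on_def slab_def)
  moreover have "(\<Union>n. B \<inter> slab v k n) = B" by (auto simp: slab_def)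
  ultimately show ?thesis by (simp add: emeasure_hausdorff_measure)
qed

text \<open>The slabs of each level partition \<open>B\<close>, so a bound valid for every
  sigma-compact part of \<open>B\<close> can be summed without loss. This is why the hypothesis
  ranges over all such parts.\<close>

lemma nn_integral_crossings_le:
  fixes v :: "'a::euclidean_space"
  assumes v: "norm v = 1" and B: "sigma_compact B"
    and le: "\<And>C. sigma_compact C \<Longrightarrow> C \<subseteq> B \<Longrightarrow> hausdorff_outer m (projection v ` C) \<le> a * hausdorff_outer m C"
  shows "(\<integral>\<^sup>+u\<in>perp v. crossings v B u \<partial>hausdorff_measure m) \<le> a * hausdorff_outer m B"
  unfolding nn_integral_crossings[OF v B]
proof (rule SUP_least)
  fix k
  have "(\<Sum>n. hausdorff_outer m (projection v ` (B \<inter> slab v k n))) \<le> (\<Sum>n. a * hausdorff_outer m (B \<inter> slab v k n))"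
    by (intro suminf_le le sigma_compact_Int sigma_compact_slab B) auto
  then show "(\<Sum>n. hausdorff_outer m (projection v ` (B \<inter> slab v k n))) \<le> a * hausdorff_outer m B"
    by (simp add: suminf_hausdorff_slabs sigma_compact_borel[OF B])
qed

lemma le_nn_integral_crossings:
  fixes v :: "'a::euclidean_space"
  assumes v: "norm v = 1" and B: "sigma_compact B"
    and le: "\<And>C. sigma_compact C \<Longrightarrow> C \<subseteq> B \<Longrightarrow> a * hausdorff_outer m C \<le> L * hausdorff_outer m (projection v ` C)"
  shows "a * hausdorff_outer m B \<le> L * (\<integral>\<^sup>+u\<in>perp v. crossings v B u \<partial>hausdorff_measure m)"
proof -
  \<comment> \<open>Any fixed level bounds the supremum from below, so level 0 suffices
    here.\<close>
  have "a * hausdorff_outer m B = (\<Sum>n. a * hausdorff_outer m (B \<inter> slab v 0 n))"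
    by (simp add: suminf_hausdorff_slabs sigma_compact_borel[OF B])
  also have "\<dots> \<le> (\<Sum>n. L * hausdorff_outer m (projection v ` (B \<inter> slab v 0 n)))"
    by (intro suminf_le le sigma_compact_Int sigma_compact_slab B) auto
  also have "\<dots> = L * (\<Sum>n. hausdorff_outer m (projection v ` (B \<inter> slab v 0 n)))" by simp
  also have "\<dots> \<le> L * (\<integral>\<^sup>+u\<in>perp v. crossings v B u \<partial>hausdorff_measure m)"
    unfolding nn_integral_crossings[OF v B] by (intro mult_left_mono SUP_upper) auto
  finally show ?thesis .
qed

section \<open>Flat pieces of the boundary\<close>

text \<open>
  A quantitative form of \<^const>\<open>outward_unit_normal\<close>, which defines a closed set of pairs \<open>(q, n)\<close>.
  Projecting compact subsets of it avoids any measurability question about the normal field.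
\<close>

definition normal_up_to :: "'a::euclidean_space set \<Rightarrow> real \<Rightarrow> real \<Rightarrow> 'a \<Rightarrow> 'a \<Rightarrow> bool" where
  "normal_up_to K \<epsilon> \<rho> q n \<longleftrightarrow> norm n = 1 \<and> (\<forall>r. 0 < r \<and> r < \<rho> \<longrightarrow>
     measure lebesgue {x \<in> ball q r \<inter> K. 0 < (x - q) \<bullet> n} \<le> \<epsilon> * r ^ DIM('a) \<and>
     measure lebesgue {x \<in> ball q r - K. (x - q) \<bullet> n < 0} \<le> \<epsilon> * r ^ DIM('a))"

section \<open>Limits in the density bounds\<close>

lemma lmeasurable_half_ball:
  fixes K :: "'a::euclidean_space set"
  assumes [measurable]: "K \<in> sets borel"
  shows "{x \<in> ball q r \<inter> K. 0 < (x - q) \<bullet> n} \<in> lmeasurable"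
    and "{x \<in> ball q r - K. (x - q) \<bullet> n < 0} \<in> lmeasurable"
proof -
  have "{x \<in> ball q r \<inter> K. 0 < (x - q) \<bullet> n} \<in> sets borel" "{x \<in> ball q r - K. (x - q) \<bullet> n < 0} \<in> sets borel"
    by measurable
  moreover have "bounded {x \<in> ball q r \<inter> K. 0 < (x - q) \<bullet> n}" "bounded {x \<in> ball q r - K. (x - q) \<bullet> n < 0}"
    by (rule bounded_subset[OF bounded_ball[of q r]], blast)+
  ultimately show "{x \<in> ball q r \<inter> K. 0 < (x - q) \<bullet> n} \<in> lmeasurable"
      "{x \<in> ball q r - K. (x - q) \<bullet> n < 0} \<in> lmeasurable"
    by (auto intro!: bounded_set_imp_lmeasurable sets_completionI_sets)
qed

lemma outward_unit_normal_imp_normal_up_to: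
  assumes "outward_unit_normal K q n" "0 < \<epsilon>"
  shows "\<exists>k. normal_up_to K \<epsilon> (1 / real (Suc k)) q n"
proof -
  let ?f = "\<lambda>r. measure lebesgue {x \<in> ball q r \<inter> K. 0 < (x - q) \<bullet> n}"
  let ?g = "\<lambda>r. measure lebesgue {x \<in> ball q r - K. (x - q) \<bullet> n < 0}"
  have "\<forall>\<^sub>F r in at_right 0. ?f r / r ^ DIM('a) < \<epsilon>" "\<forall>\<^sub>F r in at_right 0. ?g r / r ^ DIM('a) < \<epsilon>"
    using assms unfolding outward_unit_normal_def by (auto dest!: order_tendstoD(2))
  then have "\<forall>\<^sub>F r in at_right 0. ?f r / r ^ DIM('a) < \<epsilon> \<and> ?g r / r ^ DIM('a) < \<epsilon>"
    by (rule eventually_conj)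
  then obtain \<rho> where "0 < \<rho>"
    and \<rho>: "\<And>r. 0 < r \<Longrightarrow> r < \<rho> \<Longrightarrow> ?f r / r ^ DIM('a) < \<epsilon> \<and> ?g r / r ^ DIM('a) < \<epsilon>"
    unfolding eventually_at_right_field by blast
  obtain k where "inverse (real (Suc k)) < \<rho>" using reals_Archimedean[OF \<open>0 < \<rho>\<close>] by blast
  then have "?f r \<le> \<epsilon> * r ^ DIM('a) \<and> ?g r \<le> \<epsilon> * r ^ DIM('a)" if "0 < r" "r < 1 / real (Suc k)" for r
  proof -
    have "r < \<rho>"
      using that(2) \<open>inverse (real (Suc k)) < \<rho>\<close> unfolding inverse_eq_divide by (rule less_trans)
    then have "?f r / r ^ DIM('a) < \<epsilon>" "?g r / r ^ DIM('a) < \<epsilon>" using \<rho> that(1) by blast+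
    then show ?thesis
      using that(1) by (simp_all only: pos_divide_less_eq zero_less_power less_imp_le simp_thms)
  qed
  then show ?thesis
    using assms(1) unfolding normal_up_to_def outward_unit_normal_def by blast
qed

text \<open>Fatou's lemma for sets: \<open>T\<close> is contained in the lower limit of the
  \<open>S k\<close>.\<close>

lemma measure_le_of_eventually_mem:
  fixes S :: "nat \<Rightarrow> 'a::euclidean_space set"
  assumes S: "\<And>k. S k \<in> lmeasurable" "\<And>k. measure lebesgue (S k) \<le> c"
    and T: "T \<in> lmeasurable" "\<And>x. x \<in> T \<Longrightarrow> \<forall>\<^sub>F k in sequentially. x \<in> S k"
  shows "measure lebesgue T \<le> c"
proof -
  define A where "A k = (\<Inter>j\<in>{k..}. S j)" for k
  have "0 \<le> c" using S(2)[of 0] measure_nonneg order_trans by blast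
  have Ameas: "A k \<in> sets lebesgue" for k
    unfolding A_def using S(1) by (intro sets.countable_INT') (auto simp: fmeasurableD)
  have "emeasure lebesgue T \<le> emeasure lebesgue (\<Union>k. A k)"
    using T(2) Ameas by (intro emeasure_mono) (fastforce simp: A_def eventually_sequentially)+
  also have "\<dots> = (SUP k. emeasure lebesgue (A k))"
    using Ameas by (intro SUP_emeasure_incseq[symmetric]) (auto simp: incseq_def A_def)
  also have "\<dots> \<le> ennreal c"
  proof (rule SUP_least)
    fix k
    have "emeasure lebesgue (A k) \<le> emeasure lebesgue (S k)"
      using S(1) by (intro emeasure_mono) (auto simp: A_def fmeasurableD)
    also have "\<dots> \<le> ennreal c"
      using S by (simp add: emeasure_eq_measure2 ennreal_leI)
    finally show "emeasure lebesgue (A k) \<le> ennreal c" .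
  qed
  finally show ?thesis
    using T(1) \<open>0 \<le> c\<close> by (simp add: emeasure_eq_measure2)
qed

text \<open>The conditions linking \<open>x\<close> to \<open>q\<close> and \<open>n\<close> are
  strict, and membership in \<open>K\<close> does not involve \<open>q\<close> and \<open>n\<close>.
  So a point of a limiting half-ball lies in almost all the approximating ones, and the measure
  bound passes to the limit.\<close>

lemma closed_normal_up_to:
  fixes K :: "'a::euclidean_space set"
  assumes K: "K \<in> sets borel"
  shows "closed {(q, n). normal_up_to K \<epsilon> \<rho> q n}"
  unfolding closed_sequential_limits
proof (intro allI impI, elim conjE)
  fix X :: "nat \<Rightarrow> 'a \<times> 'a" and l
  assume X: "\<forall>k. X k \<in> {(q, n). normal_up_to K \<epsilon> \<rho> q n}" and lim: "X \<longlonglongrightarrow> l"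
  obtain q n where l: "l = (q, n)" by (cases l)
  define Q where "Q k = fst (X k)" for k
  define N where "N k = snd (X k)" for k
  have QN: "Q \<longlonglongrightarrow> q" "N \<longlonglongrightarrow> n"
    using tendsto_fst[OF lim] tendsto_snd[OF lim] by (simp_all add: Q_def[abs_def] N_def[abs_def] l)
  have nu: "normal_up_to K \<epsilon> \<rho> (Q k) (N k)" for k
    using X[rule_format, of k] by (simp add: Q_def N_def case_prod_beta)
  have "(\<lambda>k. norm (N k)) \<longlonglongrightarrow> norm n" using QN(2) by (rule tendsto_norm)
  then have "norm n = 1"
    using nu by (simp add: normal_up_to_def LIMSEQ_const_iff)
  moreover have "measure lebesgue {x \<in> ball q r \<inter> K. 0 < (x - q) \<bullet> n} \<le> \<epsilon> * r ^ DIM('a) \<and>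
     measure lebesgue {x \<in> ball q r - K. (x - q) \<bullet> n < 0} \<le> \<epsilon> * r ^ DIM('a)"
    if r: "0 < r" "r < \<rho>" for r
  proof (intro conjI)
    have d: "(\<lambda>k. dist (Q k) x) \<longlonglongrightarrow> dist q x" "(\<lambda>k. (x - Q k) \<bullet> N k) \<longlonglongrightarrow> (x - q) \<bullet> n" for x
      using QN by (auto intro!: tendsto_intros)
    show "measure lebesgue {x \<in> ball q r \<inter> K. 0 < (x - q) \<bullet> n} \<le> \<epsilon> * r ^ DIM('a)"
    proof (rule measure_le_of_eventually_mem)
      fix x assume x: "x \<in> {x \<in> ball q r \<inter> K. 0 < (x - q) \<bullet> n}"
      then have "\<forall>\<^sub>F k in sequentially. dist (Q k) x < r" "\<forall>\<^sub>F k in sequentially. 0 < (x - Q k) \<bullet> N k"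
        using d[of x] by (auto intro: order_tendstoD)
      then show "\<forall>\<^sub>F k in sequentially. x \<in> {x \<in> ball (Q k) r \<inter> K. 0 < (x - Q k) \<bullet> N k}"
        by eventually_elim (use x in auto)
    next
      fix k
      show "measure lebesgue {x \<in> ball (Q k) r \<inter> K. 0 < (x - Q k) \<bullet> N k} \<le> \<epsilon> * r ^ DIM('a)"
        using nu[of k] r unfolding normal_up_to_def by blast
    qed (rule lmeasurable_half_ball(1)[OF K])+
    show "measure lebesgue {x \<in> ball q r - K. (x - q) \<bullet> n < 0} \<le> \<epsilon> * r ^ DIM('a)"
    proof (rule measure_le_of_eventually_mem)
      fix x assume x: "x \<in> {x \<in> ball q r - K. (x - q) \<bullet> n < 0}"
      then have "\<forall>\<^sub>F k in sequentially. dist (Q k) x < r" "\<forall>\<^sub>F k in sequentially. (x - Q k) \<bullet> N k < 0"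
        using d[of x] by (auto intro: order_tendstoD)
      then show "\<forall>\<^sub>F k in sequentially. x \<in> {x \<in> ball (Q k) r - K. (x - Q k) \<bullet> N k < 0}"
        by eventually_elim (use x in auto)
    next
      fix k
      show "measure lebesgue {x \<in> ball (Q k) r - K. (x - Q k) \<bullet> N k < 0} \<le> \<epsilon> * r ^ DIM('a)"
        using nu[of k] r unfolding normal_up_to_def by blast
    qed (rule lmeasurable_half_ball(2)[OF K])+
  qed
  ultimately show "l \<in> {(q, n). normal_up_to K \<epsilon> \<rho> q n}" by (simp add: normal_up_to_def l)
qed

text \<open>Volume comparison: the two sets together have measure at most
  \<open>2 * \<epsilon> * r ^ DIM('a)\<close>, too little for a ball of radius
  \<open>s\<close>.\<close>

lemma no_ball_in_two_half_balls:
  fixes K :: "'a::euclidean_space set"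
  assumes K: "K \<in> sets borel"
    and "normal_up_to K \<epsilon> \<rho> p n" "0 < r" "r < \<rho>"
    and "normal_up_to K \<epsilon> \<rho>' p' n'" "0 < r'" "r' < \<rho>'" "r' \<le> r"
    and small: "2 * \<epsilon> * r ^ DIM('a) < unit_ball_vol (real DIM('a)) * s ^ DIM('a)" and "0 < s"
  shows "\<not> ball z s \<subseteq> {x \<in> ball p r \<inter> K. 0 < (x - p) \<bullet> n} \<union> {x \<in> ball p' r' - K. (x - p') \<bullet> n' < 0}"
    and "\<not> ball z s \<subseteq> {x \<in> ball p r - K. (x - p) \<bullet> n < 0} \<union> {x \<in> ball p' r' \<inter> K. 0 < (x - p') \<bullet> n'}"
proof -
  have bd: "measure lebesgue {x \<in> ball p r \<inter> K. 0 < (x - p) \<bullet> n} \<le> \<epsilon> * r ^ DIM('a)"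
      "measure lebesgue {x \<in> ball p r - K. (x - p) \<bullet> n < 0} \<le> \<epsilon> * r ^ DIM('a)"
      "measure lebesgue {x \<in> ball p' r' \<inter> K. 0 < (x - p') \<bullet> n'} \<le> \<epsilon> * r' ^ DIM('a)"
      "measure lebesgue {x \<in> ball p' r' - K. (x - p') \<bullet> n' < 0} \<le> \<epsilon> * r' ^ DIM('a)"
    using assms by (auto simp: normal_up_to_def)
  have "0 \<le> \<epsilon> * r ^ DIM('a)" using bd(1) measure_nonneg order_trans by blast
  then have "0 \<le> \<epsilon>" using \<open>0 < r\<close> by (metis mult_neg_pos not_le zero_less_power)
  then have r': "\<epsilon> * r' ^ DIM('a) \<le> \<epsilon> * r ^ DIM('a)"
    using assms by (intro mult_left_mono power_mono) auto
  have *: False if "S \<in> lmeasurable" "T \<in> lmeasurable" "measure lebesgue S \<le> \<epsilon> * r ^ DIM('a)"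
      "measure lebesgue T \<le> \<epsilon> * r' ^ DIM('a)" "ball z s \<subseteq> S \<union> T" for S T
  proof -
    have "unit_ball_vol (real DIM('a)) * s ^ DIM('a) = measure lebesgue (ball z s)"
      using \<open>0 < s\<close> by (simp add: content_ball)
    also have "\<dots> \<le> measure lebesgue (S \<union> T)"
      using that by (intro measure_mono_fmeasurable) (auto simp: fmeasurable.Un)
    also have "\<dots> \<le> measure lebesgue S + measure lebesgue T"
      using that by (intro measure_Un_le) (auto simp: fmeasurableD)
    finally show False using that r' small by linarith
  qed
  show "\<not> ball z s \<subseteq> {x \<in> ball p r \<inter> K. 0 < (x - p) \<bullet> n} \<union> {x \<in> ball p' r' - K. (x - p') \<bullet> n' < 0}"
    using *[OF lmeasurable_half_ball(1)[OF K] lmeasurable_half_ball(2)[OF K] bd(1,4)] by blast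
  show "\<not> ball z s \<subseteq> {x \<in> ball p r - K. (x - p) \<bullet> n < 0} \<union> {x \<in> ball p' r' \<inter> K. 0 < (x - p') \<bullet> n'}"
    using *[OF lmeasurable_half_ball(2)[OF K] lmeasurable_half_ball(1)[OF K] bd(2,3)] by blast
qed

lemma inner_less_norm_bound:
  assumes "norm (n :: 'a::real_inner) = 1" "dist z x < s"
  shows "\<bar>(x - z) \<bullet> n\<bar> < s"
  using Cauchy_Schwarz_ineq2[of "x - z" n] assms by (simp add: dist_norm norm_minus_commute)

lemma power_scale_less:
  fixes a b s t :: real
  assumes "a * 4 ^ N < b * t ^ N" "0 < s" shows "a * (4 * s) ^ N < b * (t * s) ^ N"
proof -
  have "(a * 4 ^ N) * s ^ N < (b * t ^ N) * s ^ N"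
    using assms by (intro mult_strict_right_mono) auto
  then show ?thesis by (simp only: power_mult_distrib mult.assoc)
qed

text \<open>If the chord, of length \<open>d\<close>, had normal component above
  \<open>\<tau> * d\<close>, the ball of radius \<open>\<tau> * d\<close> about \<open>q\<close>
  would lie outside as seen from \<open>p\<close>, while half of it lies inside as seen from
  \<open>q\<close>. Every point of that half, whether in \<open>K\<close> or not, is then misplaced
  for one of the two normals. A component below \<open>- \<tau> * d\<close> is symmetric.\<close>

lemma normal_up_to_flat:
  fixes K :: "'a::euclidean_space set"
  assumes K: "K \<in> sets borel" and p: "normal_up_to K \<epsilon> \<rho> p n" and q: "normal_up_to K \<epsilon> \<rho> q n'"
    and \<tau>: "0 < \<tau>" "\<tau> \<le> 1" and close: "2 * norm (q - p) < \<rho>"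
    and small: "2 * \<epsilon> * 4 ^ DIM('a) < unit_ball_vol (real DIM('a)) * \<tau> ^ DIM('a)"
  shows "\<bar>(q - p) \<bullet> n\<bar> \<le> \<tau> * norm (q - p)"
proof (rule ccontr)
  assume contr: "\<not> ?thesis"
  define d where "d = norm (q - p)"
  have "0 < d" using contr by (auto simp: d_def)
  have n: "norm n = 1" "norm n' = 1" "n' \<bullet> n' = 1"
    using p q by (auto simp: normal_up_to_def norm_eq_1)
  \<comment> \<open>The radius \<open>2 * d\<close> at \<open>p\<close> contains the ball of radius
    \<open>\<tau> * d \<le> d\<close> about \<open>q\<close>. Its ratio to the radius
    \<open>\<tau> * d / 2\<close> of the excluded ball is 4 to \<open>\<tau>\<close>, whence the
    powers in \<open>small\<close>.\<close>
  have small': "2 * \<epsilon> * (2 * d) ^ DIM('a) < unit_ball_vol (real DIM('a)) * (\<tau> * d / 2) ^ DIM('a)"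
    using power_scale_less[OF small, of "d / 2"] \<open>0 < d\<close> by simp
  have rad: "\<tau> * d \<le> d" using \<tau> \<open>0 < d\<close> by simp
  have pos: "0 < \<tau> * d / 2" "0 < \<tau> * d" using \<tau> \<open>0 < d\<close> by simp_all
  have radii: "0 < 2 * d" "2 * d < \<rho>" "\<tau> * d < \<rho>" "\<tau> * d \<le> 2 * d"
    using close rad \<open>0 < d\<close> unfolding d_def[symmetric] by linarith+
  note no = no_ball_in_two_half_balls[OF K p radii(1,2) q pos(2) radii(3,4) small' pos(1)]
  have q_ball: "dist q x < \<tau> * d" if "dist (q + t *\<^sub>R n') x < \<tau> * d / 2" "\<bar>t\<bar> = \<tau> * d / 2" for x t
    using dist_triangle[of q x "q + t *\<^sub>R n'"] that n by (simp add: dist_norm)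
  have p_ball: "dist p x < 2 * d" if "dist q x < \<tau> * d" for x
    using dist_triangle[of p x q] that rad by (simp add: dist_norm d_def norm_minus_commute)
  have split: "(x - p) \<bullet> n = (x - q) \<bullet> n + (q - p) \<bullet> n" for x by (simp add: inner_diff_left)
  have split': "(x - q) \<bullet> n' = (x - (q + t *\<^sub>R n')) \<bullet> n' + t" for x t
    by (simp add: inner_diff_left inner_add_left n)
  show False
  proof (cases "0 < (q - p) \<bullet> n")
    case True
    \<comment> \<open>Centre of a ball that touches the hyperplane through \<open>q\<close> from the
      inner side and stays within \<open>\<tau> * d\<close> of \<open>q\<close>.\<close>
    define z where "z = q + (- (\<tau> * d / 2)) *\<^sub>R n'"
    have "x \<in> {x \<in> ball p (2 * d) \<inter> K. 0 < (x - p) \<bullet> n} \<union> {x \<in> ball q (\<tau> * d) - K. (x - q) \<bullet> n' < 0}"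
      if x: "x \<in> ball z (\<tau> * d / 2)" for x
    proof -
      have dx: "dist z x < \<tau> * d / 2" using x by simp
      have dq: "dist q x < \<tau> * d" by (rule q_ball[of "- (\<tau> * d / 2)"]) (use dx pos in \<open>simp_all add: z_def\<close>)
      have "0 < (x - p) \<bullet> n"
        using inner_less_norm_bound[OF n(1) dq] contr True split[of x] by (simp add: d_def)
      moreover have "(x - q) \<bullet> n' < 0"
        using inner_less_norm_bound[OF n(2) dx] split'[of x "- (\<tau> * d / 2)"] unfolding z_def by linarith
      ultimately show ?thesis using dq p_ball[OF dq] by auto
    qed
    then show False using no(1)[of z] by blast
  next
    case False
    define z where "z = q + (\<tau> * d / 2) *\<^sub>R n'"
    have "x \<in> {x \<in> ball p (2 * d) - K. (x - p) \<bullet> n < 0} \<union> {x \<in> ball q (\<tau> * d) \<inter> K. 0 < (x - q) \<bullet> n'}"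
      if x: "x \<in> ball z (\<tau> * d / 2)" for x
    proof -
      have dx: "dist z x < \<tau> * d / 2" using x by simp
      have dq: "dist q x < \<tau> * d" by (rule q_ball[of "\<tau> * d / 2"]) (use dx pos in \<open>simp_all add: z_def\<close>)
      have "(x - p) \<bullet> n < 0"
        using inner_less_norm_bound[OF n(1) dq] contr False split[of x] by (simp add: d_def)
      moreover have "0 < (x - q) \<bullet> n'"
        using inner_less_norm_bound[OF n(2) dx] split'[of x "\<tau> * d / 2"] unfolding z_def by linarith
      ultimately show ?thesis using dq p_ball[OF dq] by auto
    qed
    then show False using no(2)[of z] by blast
  qed
qed

text \<open>The same exclusion at a single point: seen from \<open>q\<close>, the direction
  \<open>n - n'\<close> points outside for \<open>n\<close> and inside for \<open>n'\<close>. The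
  scale at which \<open>n'\<close> attains the tolerance is not controlled, so the radius is chosen
  after it.\<close>

lemma normal_up_to_close:
  fixes K :: "'a::euclidean_space set"
  assumes K: "K \<in> sets borel" and p: "normal_up_to K \<epsilon> \<rho> q n" and q: "outward_unit_normal K q n'"
    and \<tau>: "0 < \<tau>" "\<tau> \<le> 1" and "0 < \<epsilon>" "0 < \<rho>"
    and small: "2 * \<epsilon> * 4 ^ DIM('a) < unit_ball_vol (real DIM('a)) * \<tau> ^ DIM('a)"
  shows "norm (n' - n) \<le> \<tau>"
proof (rule ccontr)
  assume contr: "\<not> ?thesis"
  define \<delta> where "\<delta> = norm (n - n')"
  have "\<tau> < \<delta>" using contr by (simp add: \<delta>_def norm_minus_commute)
  then have "0 < \<delta>" using \<tau> by simp
  obtain k where p': "normal_up_to K \<epsilon> (1 / real (Suc k)) q n'"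
    using outward_unit_normal_imp_normal_up_to[OF q \<open>0 < \<epsilon>\<close>] by blast
  define r where "r = min \<rho> (1 / real (Suc k)) / 2"
  have r: "0 < r" "r < \<rho>" "r < 1 / real (Suc k)" using \<open>0 < \<rho>\<close> by (auto simp: r_def min_def field_simps)
  have n: "norm n = 1" "norm n' = 1" "n \<bullet> n = 1" "n' \<bullet> n' = 1"
    using p p' by (auto simp: normal_up_to_def norm_eq_1)
  have "\<delta>\<^sup>2 = 2 - 2 * (n \<bullet> n')"
    unfolding \<delta>_def power2_norm_eq_inner by (simp add: inner_diff_left inner_diff_right n inner_commute[of n' n])
  then have ip: "(n - n') \<bullet> n = \<delta> * \<delta> / 2" "(n - n') \<bullet> n' = - (\<delta> * \<delta> / 2)"
    by (simp_all add: inner_diff_left n inner_commute[of n' n] power2_eq_square field_simps)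
  \<comment> \<open>At distance \<open>r / 2\<close> from \<open>q\<close>, with components
    \<open>r * \<delta> / 4\<close> along \<open>n\<close> and \<open>- (r * \<delta> / 4)\<close>
    along \<open>n'\<close>. Both signs persist on the ball of radius \<open>r * \<tau> / 4\<close>,
    since \<open>\<tau> < \<delta>\<close>.\<close>
  define z where "z = q + (r / (2 * \<delta>)) *\<^sub>R (n - n')"
  have zn: "(x - q) \<bullet> n = (x - z) \<bullet> n + r * \<delta> / 4" "(x - q) \<bullet> n' = (x - z) \<bullet> n' - r * \<delta> / 4" for x
  proof -
    have "x - q = (x - z) + (r / (2 * \<delta>)) *\<^sub>R (n - n')" by (simp add: z_def)
    then have "(x - q) \<bullet> m = (x - z) \<bullet> m + (r / (2 * \<delta>)) * ((n - n') \<bullet> m)" for m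
      by (metis inner_add_left inner_scaleR_left)
    then show "(x - q) \<bullet> n = (x - z) \<bullet> n + r * \<delta> / 4" "(x - q) \<bullet> n' = (x - z) \<bullet> n' - r * \<delta> / 4"
      using \<open>0 < \<delta>\<close> by (simp_all add: ip)
  qed
  have dqz: "dist q z = r / 2" using r \<open>0 < \<delta>\<close> by (simp add: z_def dist_norm flip: \<delta>_def)
  have r\<tau>: "r * \<tau> / 4 \<le> r * \<delta> / 4" "r * \<tau> / 4 \<le> r / 2"
    using r \<open>\<tau> < \<delta>\<close> \<tau> mult_left_le[of \<tau> r] by auto
  have "x \<in> {x \<in> ball q r \<inter> K. 0 < (x - q) \<bullet> n} \<union> {x \<in> ball q r - K. (x - q) \<bullet> n' < 0}"
    if x: "x \<in> ball z (r * \<tau> / 4)" for x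
  proof -
    have dx: "dist z x < r * \<tau> / 4" using x by simp
    have "dist q x < r" using dist_triangle[of q x z] dqz dx r\<tau>(2) by linarith
    moreover have "0 < (x - q) \<bullet> n" "(x - q) \<bullet> n' < 0"
      using inner_less_norm_bound[OF n(1) dx] inner_less_norm_bound[OF n(2) dx] r\<tau>(1) zn[of x] by linarith+
    ultimately show ?thesis by auto
  qed
  moreover have "2 * \<epsilon> * r ^ DIM('a) < unit_ball_vol (real DIM('a)) * (r * \<tau> / 4) ^ DIM('a)"
    using power_scale_less[OF small, of "r / 4"] r(1) by (simp add: mult.commute)
  moreover have "0 < r * \<tau> / 4" using r \<tau> by simp
  ultimately show False
    using no_ball_in_two_half_balls(1)[OF K p r(1,2) p' r(1,3) order_refl, of "r * \<tau> / 4" z] by blast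
qed

text \<open>The index consists of a scale on which the tolerance holds, a direction from a countable
  dense set and a centre from a countable dense set. In each bound \<open>2 * \<tau>\<close>, one
  \<open>\<tau>\<close> compares a chord or a true normal with the approximate normal stored in the
  pair, the other compares the latter with \<open>w i\<close>.\<close>

lemma flat_decomposition:
  fixes K :: "'a::euclidean_space set"
  assumes K: "K \<in> sets borel" and S: "compact S" and \<tau>: "0 < \<tau>" "\<tau> \<le> 1"
  shows "\<exists>(F :: nat \<Rightarrow> 'a set) w.
    (\<forall>i. compact (F i) \<and> F i \<subseteq> S \<and> norm (w i) = 1 \<and> flat_set (2 * \<tau>) (w i) (F i)) \<and>
    (\<forall>i q n. q \<in> F i \<longrightarrow> outward_unit_normal K q n \<longrightarrow> norm (n - w i) \<le> 2 * \<tau>) \<and>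
    (\<forall>q n. q \<in> S \<longrightarrow> outward_unit_normal K q n \<longrightarrow> q \<in> (\<Union>i. F i))"
proof -
  define \<omega> where "\<omega> = unit_ball_vol (real DIM('a)) * \<tau> ^ DIM('a)"
  \<comment> \<open>Half the value at which \<open>2 * \<epsilon> * 4 ^ DIM('a)\<close> would reach
    \<open>\<omega>\<close>, so that the required inequality is strict.\<close>
  define \<epsilon> where "\<epsilon> = \<omega> / (4 * 4 ^ DIM('a))"
  have "0 < \<omega>" using \<tau> by (simp add: \<omega>_def)
  then have \<epsilon>: "0 < \<epsilon>" "2 * \<epsilon> * 4 ^ DIM('a) < unit_ball_vol (real DIM('a)) * \<tau> ^ DIM('a)"
    by (simp_all add: \<epsilon>_def flip: \<omega>_def)
  obtain T :: "'a set" where T: "countable T" "T \<subseteq> sphere 0 1" "sphere 0 1 \<subseteq> closure T"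
    by (rule separable)
  obtain P :: "'a set" where P: "countable P" "UNIV \<subseteq> closure P"
    by (rule separable[of "UNIV :: 'a set"])
  define J where "J = (UNIV :: nat set) \<times> T \<times> P"
  have "sphere (0::'a) 1 \<noteq> {}" by simp
  then have "T \<noteq> {}" "P \<noteq> {}" using T(3) P(2) by auto
  then have "J \<noteq> {}" "countable J" using T(1) P(1) by (auto simp: J_def)
  then have J: "range (from_nat_into J) = J" by (rule range_from_nat_into)
  \<comment> \<open>The radius is an eighth of the scale: two points of a piece are at most a
    quarter of the scale apart, below the half that \<open>normal_up_to_flat\<close>
    demands.\<close>
  define G where "G k w p = {(q, n). normal_up_to K \<epsilon> (1 / real (Suc k)) q n} \<inter>
      ((S \<inter> cball p (1 / (8 * real (Suc k)))) \<times> cball w \<tau>)" for k w p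
  define F where "F i = (case from_nat_into J i of (k, w, p) \<Rightarrow> fst ` G k w p)" for i
  define w where "w i = (case from_nat_into J i of (k, w, p) \<Rightarrow> w)" for i
  have elim: thesis if "\<And>k p. w i \<in> T \<Longrightarrow> F i = fst ` G k (w i) p \<Longrightarrow> thesis" for i thesis
  proof -
    obtain k u p where e: "from_nat_into J i = (k, u, p)" by (metis prod_cases3)
    moreover have "(k, u, p) \<in> J" using from_nat_into[OF \<open>J \<noteq> {}\<close>, of i] e by simp
    ultimately show ?thesis using that[of k p] by (simp add: w_def F_def J_def)
  qed
  show ?thesis
  proof (intro exI[of _ F] exI[of _ w] conjI allI impI)
    fix i
    obtain k p where i: "w i \<in> T" "F i = fst ` G k (w i) p" by (rule elim)
    have "compact (G k (w i) p)"
      unfolding G_def using S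
      by (intro closed_Int_compact closed_normal_up_to K compact_Times compact_Int_closed) auto
    then show "compact (F i)" unfolding i(2) by (intro compact_continuous_image continuous_intros)
    show "F i \<subseteq> S" by (auto simp: i(2) G_def)
    show "norm (w i) = 1" using i(1) T(2) by auto
    have Fi: "\<exists>n. normal_up_to K \<epsilon> (1 / real (Suc k)) x n \<and> dist p x \<le> 1 / (8 * real (Suc k)) \<and> dist (w i) n \<le> \<tau>"
      if "x \<in> F i" for x
      using that unfolding i(2) G_def by (elim imageE) auto
    show "flat_set (2 * \<tau>) (w i) (F i)"
      unfolding flat_set_def
    proof (intro ballI)
      fix x y assume "x \<in> F i" "y \<in> F i"
      then obtain n n' where n: "normal_up_to K \<epsilon> (1 / real (Suc k)) x n" "dist p x \<le> 1 / (8 * real (Suc k))"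
          "dist (w i) n \<le> \<tau>"
        and n': "normal_up_to K \<epsilon> (1 / real (Suc k)) y n'" "dist p y \<le> 1 / (8 * real (Suc k))"
        using Fi by meson
      have "norm (y - x) \<le> 1 / (8 * real (Suc k)) + 1 / (8 * real (Suc k))"
        using dist_triangle[of y x p] n(2) n'(2) by (simp only: dist_norm[symmetric] dist_commute)
      also have "\<dots> = (1 / real (Suc k)) / 4" by (simp add: field_simps)
      finally have "norm (y - x) \<le> (1 / real (Suc k)) / 4" .
      moreover have "2 * a < b" if "a \<le> b / 4" "0 < b" for a b :: real using that by linarith
      ultimately have "2 * norm (y - x) < 1 / real (Suc k)" by (metis zero_less_divide_1_iff of_nat_0_less_iff zero_less_Suc)
      then have "\<bar>(y - x) \<bullet> n\<bar> \<le> \<tau> * norm (y - x)"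
        by (rule normal_up_to_flat[OF K n(1) n'(1) \<tau> _ \<epsilon>(2)])
      moreover have "\<bar>(y - x) \<bullet> (w i - n)\<bar> \<le> norm (y - x) * \<tau>"
      proof (rule order_trans[OF Cauchy_Schwarz_ineq2])
        show "norm (y - x) * norm (w i - n) \<le> norm (y - x) * \<tau>"
          using n(3) by (intro mult_left_mono) (simp_all add: dist_norm)
      qed
      moreover have "(y - x) \<bullet> w i = (y - x) \<bullet> n + (y - x) \<bullet> (w i - n)" by (simp add: inner_diff_right)
      ultimately have "\<bar>(y - x) \<bullet> w i\<bar> \<le> 2 * \<tau> * norm (y - x)" by (simp add: algebra_simps)
      moreover have "(x - y) \<bullet> w i = - ((y - x) \<bullet> w i)" by (simp add: inner_diff_left)
      ultimately show "\<bar>(x - y) \<bullet> w i\<bar> \<le> 2 * \<tau> * norm (x - y)" by (simp add: norm_minus_commute)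
    qed
    fix q n assume "q \<in> F i" and n: "outward_unit_normal K q n"
    then obtain n' where n': "normal_up_to K \<epsilon> (1 / real (Suc k)) q n'" "dist (w i) n' \<le> \<tau>"
      using Fi by meson
    have "norm (n - n') \<le> \<tau>"
      by (rule normal_up_to_close[OF K n'(1) n \<tau> \<epsilon>(1) _ \<epsilon>(2)]) simp
    then show "norm (n - w i) \<le> 2 * \<tau>"
      using norm_triangle_ineq[of "n - n'" "n' - w i"] n'(2) by (simp add: dist_norm norm_minus_commute)
  next
    fix q n assume q: "q \<in> S" and n: "outward_unit_normal K q n"
    then obtain k where k: "normal_up_to K \<epsilon> (1 / real (Suc k)) q n"
      using outward_unit_normal_imp_normal_up_to[OF n \<epsilon>(1)] by blast
    have "n \<in> closure T" using n T(3) by (auto simp: outward_unit_normal_def)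
    then obtain u where u: "u \<in> T" "dist u n < \<tau>" using \<tau>(1) by (meson closure_approachable)
    have "0 < 1 / (8 * real (Suc k))" by simp
    moreover have "q \<in> closure P" using P(2) by blast
    ultimately obtain p where p: "p \<in> P" "dist p q < 1 / (8 * real (Suc k))"
      by (meson closure_approachable)
    have "(k, u, p) \<in> range (from_nat_into J)" unfolding J using u p by (simp add: J_def)
    then obtain i where i: "from_nat_into J i = (k, u, p)" by (metis imageE)
    have "(q, n) \<in> G k u p" using k q u p by (auto simp: G_def)
    then have "q \<in> F i" by (force simp: F_def i)
    then show "q \<in> (\<Union>i. F i)" by blast
  qed
qed

section \<open>The projected area\<close>

lemma suminf_indicator_disjoint:
  fixes a :: "nat \<Rightarrow> ennreal"
  assumes "disjoint_family B" "x \<in> B i"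
  shows "(\<Sum>j. a j * indicator (B j) x) = a i"
proof -
  have "a j * indicator (B j) x = (if j = i then a i else 0)" for j
    using assms by (auto simp: disjoint_family_on_def indicator_def)
  then have "(\<Sum>j. a j * indicator (B j) x) = (\<Sum>j\<in>{i}. a j * indicator (B j) x)"
    by (intro suminf_finite) auto
  then show ?thesis using assms(2) by simp
qed

lemma crossings_disjoint_Union:
  fixes B :: "nat \<Rightarrow> 'a::real_vector set"
  assumes "disjoint_family B"
  shows "crossings v (\<Union>i. B i) u = (\<Sum>i. crossings v (B i) u)"
  unfolding crossings_def Int_UN_distrib
  using assms by (intro suminf_emeasure[symmetric]) (auto simp: disjoint_family_on_def)

lemma crossings_Un_null:
  assumes "u \<notin> projection v ` N" "v \<bullet> u = 0" "norm v = 1"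
  shows "crossings v (B \<union> N) u = crossings v B u"
proof -
  have "line v u \<inter> N = {}"
  proof (rule ccontr)
    assume "line v u \<inter> N \<noteq> {}"
    then obtain t where "u + t *\<^sub>R v \<in> N" by (auto simp: line_def)
    moreover have "projection v (u + t *\<^sub>R v) = u"
      using assms by (simp add: projection_def inner_add_left inner_commute[of u v] norm_eq_1)
    ultimately show False using assms(1) by (metis image_eqI)
  qed
  then show ?thesis by (simp add: crossings_def Int_Un_distrib)
qed

text \<open>Both \<open>A\<close> and \<open>C\<close> are compared with the sum of
  \<open>\<bar>v \<bullet> w i\<bar> * H(B i)\<close> over the pieces. The Lipschitz factor is
  squared in the second estimate because the lower bound for projected areas loses it twice.\<close>

lemma projected_area_estimates:
  fixes K S :: "'a::euclidean_space set" and v :: 'a and \<nu> :: "'a \<Rightarrow> 'a" and m :: nat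
  defines "m \<equiv> DIM('a) - 1"
  defines "A \<equiv> (\<integral>\<^sup>+q\<in>S. ennreal \<bar>v \<bullet> \<nu> q\<bar> \<partial>hausdorff_measure m)"
  defines "C \<equiv> (\<integral>\<^sup>+u\<in>perp v. crossings v S u \<partial>hausdorff_measure m)"
  assumes K: "K \<in> sets borel" and S: "compact S"
    and normal: "AE q in hausdorff_measure m. q \<in> S \<longrightarrow> outward_unit_normal K q (\<nu> q)"
    and v: "norm v = 1" and \<eta>: "0 < \<eta>" "\<eta> \<le> 1/2"
  shows "C \<le> ennreal ((1 + 2 * \<eta>) ^ m) * (A + ennreal (2 * \<eta>) * hausdorff_outer m S)"
    and "A \<le> ennreal ((1 + 2 * \<eta>) ^ m * (1 + 2 * \<eta>) ^ m) * C + ennreal (2 * \<eta>) * hausdorff_outer m S"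
proof -
  let ?h = "hausdorff_outer m :: 'a set \<Rightarrow> _"
  let ?H = "hausdorff_measure m :: 'a measure"
  let ?L = "(1 + 2 * \<eta>) ^ m"
  \<comment> \<open>Chosen so that \<open>2 * \<tau>\<close> is the flatness
    \<open>\<eta>\<^sup>2 / 2\<close> needed for the projection and also at most
    \<open>\<eta>\<close>, the tolerance for the normals.\<close>
  define \<tau> where "\<tau> = \<eta>\<^sup>2 / 4"
  have "\<eta>\<^sup>2 \<le> \<eta>" using \<eta> by (simp add: power2_eq_square mult_left_le)
  then have \<tau>: "0 < \<tau>" "\<tau> \<le> 1" "2 * \<tau> \<le> \<eta>" "2 * \<tau> = \<eta>\<^sup>2 / 2"
    using \<eta> by (auto simp: \<tau>_def)
  obtain F :: "nat \<Rightarrow> 'a set" and w where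
    Fw: "\<forall>i. compact (F i) \<and> F i \<subseteq> S \<and> norm (w i) = 1 \<and> flat_set (2 * \<tau>) (w i) (F i)"
    and near: "\<forall>i q n. q \<in> F i \<longrightarrow> outward_unit_normal K q n \<longrightarrow> norm (n - w i) \<le> 2 * \<tau>"
    and cover: "\<forall>q n. q \<in> S \<longrightarrow> outward_unit_normal K q n \<longrightarrow> q \<in> (\<Union>i. F i)"
    using flat_decomposition[OF K S \<tau>(1,2)] by (elim exE conjE) (rule that)
  have F: "compact (F i)" "F i \<subseteq> S" and w: "norm (w i) = 1" and flat: "flat_set (2 * \<tau>) (w i) (F i)" for i
    using Fw by simp_all
  \<comment> \<open>Making the pieces disjoint destroys compactness, but a compact set minus
    finitely many compact ones is still sigma-compact.\<close>
  define B where "B = disjointed F"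
  define c where "c i = \<bar>v \<bullet> w i\<bar>" for i
  have BF: "B i \<subseteq> F i" for i by (simp add: B_def disjointed_subset)
  have disj: "disjoint_family B" unfolding B_def by (rule disjoint_family_disjointed)
  have UB: "(\<Union>i. B i) = (\<Union>i. F i)" unfolding B_def by (rule UN_disjointed_eq)
  have sB: "sigma_compact (B i)" for i
  proof -
    have "closed (\<Union>j<i. F j)" using F(1) by (intro closed_UN) (auto intro: compact_imp_closed)
    then have "sigma_compact (F i \<inter> - (\<Union>j<i. F j))"
      using F(1) by (intro sigma_compact_Int compact_imp_sigma_compact open_imp_sigma_compact open_Compl)
    then show ?thesis by (simp add: B_def disjointed_def atLeast0LessThan Diff_eq)
  qed
  then have [measurable]: "B i \<in> sets borel" for i by (rule sigma_compact_borel)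
  have sC: "flat_set (\<eta>\<^sup>2 / 2) (w i) D" if "D \<subseteq> B i" for i D
    using flat[of i] that BF[of i] unfolding \<tau>(4) flat_set_def by blast
  have sum_B: "(\<Sum>i. ?h (B i)) \<le> ?h S"
  proof -
    have "(\<Sum>i. emeasure ?H (B i)) = emeasure ?H (\<Union>i. B i)"
      using disj by (intro suminf_emeasure) auto
    also have "\<dots> \<le> emeasure ?H S"
      using S F(2) unfolding UB by (intro emeasure_mono) (auto intro: borel_compact)
    finally show ?thesis using S by (simp add: emeasure_hausdorff_measure borel_compact)
  qed

  \<comment> \<open>Only points where \<open>\<nu>\<close> fails to be an exterior normal are left
    over, so \<open>N\<close> is null. The lines meeting it pass through its projection, which is
    null as well, and do not affect \<open>C\<close>.\<close>
  define N where "N = S - (\<Union>i. B i)"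
  have SN: "S = (\<Union>i. B i) \<union> N" using F(2) unfolding N_def UB by blast
  have [measurable]: "N \<in> sets borel" unfolding N_def using S by (auto intro: borel_compact)
  have "AE q in ?H. q \<notin> N"
    using normal by eventually_elim (use cover in \<open>auto simp: N_def UB\<close>)
  then have "?h N = 0"
    by (simp add: AE_iff_measurable[of N] emeasure_hausdorff_measure)
  have proj_le: "dist (projection v x) (projection v y) \<le> 1 * dist x y" for x y
  proof -
    have "v \<bullet> v = 1" using v by (simp add: norm_eq_1)
    have "norm (projection v z) \<le> norm z" for z
    proof (rule power2_le_imp_le)
      have "(norm (projection v z))\<^sup>2 = (norm z)\<^sup>2 - (z \<bullet> v)\<^sup>2"
        unfolding power2_norm_eq_inner projection_def
        by (simp add: inner_diff_left inner_diff_right \<open>v \<bullet> v = 1\<close> inner_commute[of v z] power2_eq_square)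
      then show "(norm (projection v z))\<^sup>2 \<le> (norm z)\<^sup>2" by simp
    qed simp
    then show ?thesis by (simp add: dist_norm linear_diff[OF linear_projection, symmetric])
  qed
  have "?h (projection v ` N) \<le> ennreal (1 ^ m) * ?h N"
    by (rule hausdorff_outer_lipschitz_image[OF _ proj_le]) simp
  then have "?h (projection v ` N) = 0" using \<open>?h N = 0\<close> by simp
  then obtain Z where Z: "projection v ` N \<subseteq> Z" "Z \<in> null_sets ?H"
    by (rule hausdorff_outer_null_imp_null_set)

  have C: "C = (\<Sum>i. \<integral>\<^sup>+u\<in>perp v. crossings v (B i) u \<partial>?H)"
  proof -
    have "AE u in ?H. crossings v S u * indicator (perp v) u = (\<Sum>i. crossings v (B i) u * indicator (perp v) u)"
      using AE_not_in[OF Z(2)]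
    proof eventually_elim
      case (elim u)
      show ?case
      proof (cases "u \<in> perp v")
        case True
        have "crossings v S u = crossings v (\<Union>i. B i) u"
          unfolding SN using elim Z(1) True v by (intro crossings_Un_null) (auto simp: perp_def)
        then show ?thesis using True by (simp add: crossings_disjoint_Union[OF disj])
      qed simp
    qed
    then have "C = (\<integral>\<^sup>+u. (\<Sum>i. crossings v (B i) u * indicator (perp v) u) \<partial>?H)"
      unfolding C_def by (rule nn_integral_cong_AE)
    also have "\<dots> = (\<Sum>i. \<integral>\<^sup>+u\<in>perp v. crossings v (B i) u \<partial>?H)"
      using borel_measurable_crossings[OF v sB] by (intro nn_integral_suminf) simp
    finally show ?thesis .
  qed

  have simple: "(\<integral>\<^sup>+q. (\<Sum>i. ennreal (a i) * indicator (B i) q) \<partial>?H) = (\<Sum>i. ennreal (a i) * ?h (B i))" for a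
    by (subst nn_integral_suminf) (auto simp: nn_integral_cmult emeasure_hausdorff_measure)
  have close: "\<bar>\<bar>v \<bullet> \<nu> q\<bar> - c i\<bar> \<le> \<eta>" if "q \<in> B i" "outward_unit_normal K q (\<nu> q)" for q i
  proof -
    have "\<bar>v \<bullet> (\<nu> q - w i)\<bar> \<le> norm (\<nu> q - w i)"
      using Cauchy_Schwarz_ineq2[of v "\<nu> q - w i"] v by simp
    also have "norm (\<nu> q - w i) \<le> 2 * \<tau>" using near that BF by blast
    then have "norm (\<nu> q - w i) \<le> \<eta>" using \<tau>(3) by simp
    finally show ?thesis by (simp add: c_def inner_diff_right)
  qed
  have A_le: "A \<le> (\<Sum>i. ennreal (c i + \<eta>) * ?h (B i))"
    unfolding simple[symmetric] A_def
  proof (rule nn_integral_mono_AE, use normal in eventually_elim)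
    case (elim q)
    show ?case
    proof (cases "q \<in> S")
      case True
      then obtain i where i: "q \<in> B i" using cover elim UB by blast
      show ?thesis
        using close[OF i] elim True suminf_indicator_disjoint[OF disj i] by (auto intro!: ennreal_leI simp: abs_le_iff)
    qed simp
  qed
  \<comment> \<open>The truncation at 0 keeps the lower factor nonnegative on pieces with
    \<open>c i < \<eta>\<close>.\<close>
  have le_A: "(\<Sum>i. ennreal (max (c i - \<eta>) 0) * ?h (B i)) \<le> A"
    unfolding simple[symmetric] A_def
  proof (rule nn_integral_mono_AE, use normal in eventually_elim)
    case (elim q)
    show ?case
    proof (cases "\<exists>i. q \<in> B i")
      case True
      then obtain i where i: "q \<in> B i" by blast
      then have "q \<in> S" using BF F(2) by blast
      then show ?thesis
        using close[OF i] elim suminf_indicator_disjoint[OF disj i] by (auto intro!: ennreal_leI simp: abs_le_iff)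
    qed simp
  qed

  have proj: "?h (projection v ` D) \<le> ennreal ?L * (ennreal (c i + \<eta>) * ?h D) \<and>
      (\<eta> \<le> c i \<longrightarrow> ennreal (c i) * ?h D \<le> ennreal ?L * (ennreal ?L * ?h (projection v ` D)))"
    if "sigma_compact D" "D \<subseteq> B i" for i D
    unfolding c_def by (rule flat_set_projection[OF v w \<eta> that(1) sC[OF that(2)] m_def[THEN meta_eq_to_obj_eq]])
  have C_i_le: "(\<integral>\<^sup>+u\<in>perp v. crossings v (B i) u \<partial>?H) \<le> ennreal ?L * ennreal (c i + \<eta>) * ?h (B i)" for i
    using proj by (intro nn_integral_crossings_le[OF v sB]) (auto simp: mult.assoc)
  \<comment> \<open>For \<open>c i < \<eta>\<close> the projection may collapse the piece and no
    lower bound is available; then \<open>c i + \<eta>\<close> is below \<open>2 * \<eta>\<close>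
    and the error term absorbs the left side.\<close>
  have le_C_i: "ennreal (c i + \<eta>) * ?h (B i)
      \<le> ennreal ?L * ennreal ?L * (\<integral>\<^sup>+u\<in>perp v. crossings v (B i) u \<partial>?H) + ennreal (2 * \<eta>) * ?h (B i)" for i
  proof (cases "\<eta> \<le> c i")
    case True
    have "ennreal (c i) * ?h (B i) \<le> ennreal ?L * ennreal ?L * (\<integral>\<^sup>+u\<in>perp v. crossings v (B i) u \<partial>?H)"
      using proj True by (intro le_nn_integral_crossings[OF v sB]) (auto simp: mult.assoc)
    moreover have "ennreal \<eta> * ?h (B i) \<le> ennreal (2 * \<eta>) * ?h (B i)"
      using \<eta> by (intro mult_right_mono ennreal_leI) auto
    moreover have "ennreal (c i + \<eta>) = ennreal (c i) + ennreal \<eta>"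
      using \<eta> by (simp add: c_def)
    ultimately show ?thesis by (simp only: distrib_right add_mono)
  next
    case False
    then have "ennreal (c i + \<eta>) * ?h (B i) \<le> ennreal (2 * \<eta>) * ?h (B i)"
      by (intro mult_right_mono ennreal_leI) auto
    then show ?thesis by (simp add: add_increasing)
  qed

  have "C \<le> (\<Sum>i. ennreal ?L * ennreal (c i + \<eta>) * ?h (B i))"
    unfolding C by (intro suminf_le C_i_le) auto
  \<comment> \<open>Adding \<open>2 * \<eta>\<close> to the truncated factor dominates
    \<open>c i + \<eta>\<close>, so the sum from \<open>le_A\<close> reappears together with a small
    multiple of the total area.\<close>
  also have "\<dots> \<le> (\<Sum>i. ennreal ?L * (ennreal (max (c i - \<eta>) 0) * ?h (B i) + ennreal (2 * \<eta>) * ?h (B i)))"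
  proof (intro suminf_le)
    fix i
    have "ennreal (c i + \<eta>) \<le> ennreal (max (c i - \<eta>) 0 + 2 * \<eta>)"
      by (intro ennreal_leI) auto
    also have "\<dots> = ennreal (max (c i - \<eta>) 0) + ennreal (2 * \<eta>)"
      using \<eta> by (intro ennreal_plus) auto
    finally have "ennreal (c i + \<eta>) * ?h (B i) \<le> (ennreal (max (c i - \<eta>) 0) + ennreal (2 * \<eta>)) * ?h (B i)"
      by (rule mult_right_mono) simp
    then show "ennreal ?L * ennreal (c i + \<eta>) * ?h (B i)
        \<le> ennreal ?L * (ennreal (max (c i - \<eta>) 0) * ?h (B i) + ennreal (2 * \<eta>) * ?h (B i))"
      unfolding mult.assoc distrib_right by (intro mult_left_mono) auto
  qed auto
  also have "\<dots> = ennreal ?L * ((\<Sum>i. ennreal (max (c i - \<eta>) 0) * ?h (B i)) + ennreal (2 * \<eta>) * (\<Sum>i. ?h (B i)))"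
    by (simp add: suminf_add[symmetric])
  also have "\<dots> \<le> ennreal ?L * (A + ennreal (2 * \<eta>) * ?h S)"
    using le_A sum_B by (intro mult_left_mono add_mono) auto
  finally show "C \<le> ennreal ?L * (A + ennreal (2 * \<eta>) * ?h S)" .

  have "A \<le> (\<Sum>i. ennreal ?L * ennreal ?L * (\<integral>\<^sup>+u\<in>perp v. crossings v (B i) u \<partial>?H) + ennreal (2 * \<eta>) * ?h (B i))"
    using A_le by (rule order_trans) (intro suminf_le le_C_i, auto)
  also have "\<dots> = ennreal ?L * ennreal ?L * C + ennreal (2 * \<eta>) * (\<Sum>i. ?h (B i))"
    unfolding C by (simp add: suminf_add[symmetric])
  also have "\<dots> \<le> ennreal ?L * ennreal ?L * C + ennreal (2 * \<eta>) * ?h S"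
    using sum_B by (intro add_left_mono mult_left_mono) auto
  finally show "A \<le> ennreal (?L * ?L) * C + ennreal (2 * \<eta>) * ?h S"
    using \<eta> by (simp add: ennreal_mult)
qed

text \<open>The finite area of \<open>S\<close> makes the additive errors vanish with
  \<open>\<eta>\<close>, while the multiplicative factors tend to 1.\<close>

lemma projected_area_eq_crossings:
  fixes K S :: "'a::euclidean_space set" and v :: 'a and \<nu> :: "'a \<Rightarrow> 'a"
  assumes K: "K \<in> sets borel" and S: "compact S" "hausdorff_outer (DIM('a) - 1) S < \<infinity>"
    and normal: "AE q in hausdorff_measure (DIM('a) - 1). q \<in> S \<longrightarrow> outward_unit_normal K q (\<nu> q)"
    and v: "norm v = 1"
  shows "(\<integral>\<^sup>+q\<in>S. ennreal \<bar>v \<bullet> \<nu> q\<bar> \<partial>hausdorff_measure (DIM('a) - 1))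
    = (\<integral>\<^sup>+u\<in>perp v. crossings v S u \<partial>hausdorff_measure (DIM('a) - 1))" (is "?A = ?C")
proof -
  let ?m = "DIM('a) - 1"
  \<comment> \<open>The double successor makes the first value \<open>1 / 2\<close>, the largest
    tolerance that the estimates admit.\<close>
  define e where "e k = 1 / real (Suc (Suc k))" for k
  have e: "0 < e k" "e k \<le> 1 / 2" for k by (auto simp: e_def divide_simps)
  have "e \<longlonglongrightarrow> 0"
    using LIMSEQ_Suc[OF LIMSEQ_inverse_real_of_nat] by (simp add: e_def[abs_def] inverse_eq_divide)
  then have "(\<lambda>k. (1 + 2 * e k) ^ ?m) \<longlonglongrightarrow> (1 + 2 * 0) ^ ?m" "(\<lambda>k. 2 * e k) \<longlonglongrightarrow> 2 * 0"
    by (intro tendsto_intros; assumption)+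
  then have lim: "(\<lambda>k. (1 + 2 * e k) ^ ?m) \<longlonglongrightarrow> 1" "(\<lambda>k. 2 * e k) \<longlonglongrightarrow> 0" by simp_all
  have L1: "(\<lambda>k. ennreal ((1 + 2 * e k) ^ ?m)) \<longlonglongrightarrow> ennreal 1" by (intro tendsto_ennrealI lim)
  have "(\<lambda>k. (1 + 2 * e k) ^ ?m * (1 + 2 * e k) ^ ?m) \<longlonglongrightarrow> 1 * 1" by (intro tendsto_intros lim)
  then have L2: "(\<lambda>k. ennreal ((1 + 2 * e k) ^ ?m * (1 + 2 * e k) ^ ?m)) \<longlonglongrightarrow> ennreal (1 * 1)"
    by (intro tendsto_ennrealI)
  have "(\<lambda>k. ennreal (2 * e k) * hausdorff_outer ?m S) \<longlonglongrightarrow> ennreal 0 * hausdorff_outer ?m S"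
    using S(2) by (intro tendsto_mult_ennreal tendsto_ennrealI lim tendsto_const) auto
  then have R: "(\<lambda>k. ennreal (2 * e k) * hausdorff_outer ?m S) \<longlonglongrightarrow> 0" by simp
  note est = projected_area_estimates[OF K S(1) normal v e]
  show ?thesis
  proof (rule antisym)
    have "(\<lambda>k. ennreal ((1 + 2 * e k) ^ ?m * (1 + 2 * e k) ^ ?m) * ?C + ennreal (2 * e k) * hausdorff_outer ?m S)
        \<longlonglongrightarrow> ennreal (1 * 1) * ?C + 0"
      by (intro tendsto_add tendsto_mult_ennreal L2 tendsto_const R) auto
    then have "?A \<le> ennreal (1 * 1) * ?C + 0"
      using est(2) by (intro LIMSEQ_le_const) auto
    then show "?A \<le> ?C" by simp
    have "(\<lambda>k. ?A + ennreal (2 * e k) * hausdorff_outer ?m S) \<longlonglongrightarrow> ?A + 0"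
      by (intro tendsto_add tendsto_const R)
    then have "(\<lambda>k. ennreal ((1 + 2 * e k) ^ ?m) * (?A + ennreal (2 * e k) * hausdorff_outer ?m S))
        \<longlonglongrightarrow> ennreal 1 * (?A + 0)"
      by (intro tendsto_mult_ennreal L1) auto
    then have "?C \<le> ennreal 1 * (?A + 0)"
      using est(1) by (intro LIMSEQ_le_const) auto
    then show "?C \<le> ?A" by simp
  qed
qed

theorem lemma2:
  fixes K :: "'a::euclidean_space set" and \<Sigma> :: "'a set" and v :: 'a and \<nu> :: "'a \<Rightarrow> 'a"
  assumes "compact K"
    and "full_dim_submanifold K"
    and "\<Sigma> = manifold_boundary K"
    and "rectifiable (DIM('a) - 1) \<Sigma>"
    and "AE q in hausdorff_measure (DIM('a) - 1). q \<in> \<Sigma> \<longrightarrow> outward_unit_normal K q (\<nu> q)"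
    and "norm v = 1"
  shows "weighted_projected_area \<Sigma> \<nu> v =
      1 / 2 * (\<integral>\<^sup>+ u\<in>{u. v \<bullet> u = 0}.
        emeasure (count_space UNIV) ({u + t *\<^sub>R v | t. True} \<inter> \<Sigma>)
        \<partial>hausdorff_measure (DIM('a) - 1))"
proof -
  \<comment> \<open>Invariance of domain identifies the boundary defined by charts with the
    topological frontier, which is compact.\<close>
  have "\<Sigma> = frontier K"
    using assms(1-3) by (simp add: manifold_boundary_eq_frontier compact_imp_closed)
  then have "compact \<Sigma>" using assms(1) by (simp add: compact_frontier)
  moreover have "hausdorff_outer (DIM('a) - 1) \<Sigma> < \<infinity>" using assms(4) by (simp add: rectifiable_def)
  ultimately show ?thesis
    using projected_area_eq_crossings[OF borel_compact[OF assms(1)] _ _ assms(5,6)]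
    by (simp add: weighted_projected_area_def perp_def crossings_def line_def)
qed

end
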